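(* Let $\Gamma$ be an arithmetic Fuchsian group such that $\Sigma=\mathbb{H}/\Gamma$ is a closed orientable hyperbolic surface. Then every angle $\theta$ in the angle spectrum of $\Sigma$ has infinite multiplicity.
   Context: A Fuchsian group is arithmetic if it is commensurable, up to conjugation in $\mathrm{PSL}(2,\mathbb{R})$, with the image in $\mathrm{PSL}(2,\mathbb{R})$ of the group of norm-one units of an order in a quaternion algebra over a totally real number field that is split at exactly one real place. If $\alpha,\beta$ are primitive closed geodesics on $\Sigma$ which meet (transversely) at a point $z\in\Sigma$, then $\alpha\angle_z\beta\in\,]0,\pi[$ denotes the angle at $z$ measured in the counter-clockwise direction from $\alpha$ to $\beta$. The angle spectrum of $\Sigma$ is the collection of all such angles, over all ordered pairs $(\alpha,\beta)$ and all their intersections $z$, counted with multiplicity; the multiplicity of a value $\theta$ is the number of such intersections with $\alpha\angle_z\beta=\theta$. *)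

theory Defs
  imports
    "HOL-Analysis.Analysis"
    "HOL-Algebra.Algebra"
    "HOL-Algebra.Algebraic_Closure_Type"
begin

section \<open>The group PSL(2,R) and its action on the upper half-plane\<close>

definition SL2R :: "(real^2^2) monoid" where
  "SL2R = \<lparr>carrier = {A. det A = 1}, monoid.mult = (**), one = mat 1\<rparr>"

text \<open>Elements of \<open>PSL2R\<close> are the cosets \<open>{A, - A}\<close>. Hence, for a subgroup \<open>\<Gamma>\<close> of \<open>PSL2R\<close>,
  the union \<open>\<Union>\<Gamma>\<close> is its full preimage in \<open>SL2R\<close>.\<close>

definition PSL2R :: "(real^2^2) set monoid" where
  "PSL2R = SL2R Mod {mat 1, - mat 1}"

lemma group_SL2R: "group SL2R"
proof (rule groupI)
  fix A assume "A \<in> carrier SL2R"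
  then have d: "det A = 1" by (simp add: SL2R_def)
  then obtain B where B: "B ** A = mat 1" "A ** B = mat 1"
    by (metis invertible_def invertible_det_nz zero_neq_one)
  have "det B * det A = 1" by (metis B(1) det_I det_mul)
  with d B show "\<exists>B\<in>carrier SL2R. B \<otimes>\<^bsub>SL2R\<^esub> A = \<one>\<^bsub>SL2R\<^esub>"
    by (auto simp: SL2R_def intro!: bexI[of _ B])
qed (auto simp: SL2R_def det_mul matrix_mul_assoc)

lemma matrix_mul_minus_left: "(- A) ** B = - (A ** B)" for A B :: "real^2^2"
  by (simp add: matrix_matrix_mult_def vec_eq_iff sum_negf)
lemma matrix_mul_minus_right: "A ** (- B) = - (A ** B)" for A B :: "real^2^2"
  by (simp add: matrix_matrix_mult_def vec_eq_iff sum_negf)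

lemma normal_SL2R: "{mat 1, - mat 1} \<lhd> SL2R"
proof -
  interpret group SL2R by (rule group_SL2R)
  have m: "det (- mat 1 :: real^2^2) = 1" by (simp add: det_2 mat_def)
  have i: "inv\<^bsub>SL2R\<^esub> (- mat 1) = - mat 1"
    by (rule inv_equality) (auto simp: SL2R_def m matrix_mul_minus_left)
  have "subgroup {mat 1, - mat 1} SL2R"
    by (rule subgroup.intro)
      (auto simp: i m SL2R_def matrix_mul_minus_left matrix_mul_minus_right
         inv_one[unfolded SL2R_def, simplified] i[unfolded SL2R_def])
  then show ?thesis
    by (rule normalI) (auto simp: r_coset_def l_coset_def SL2R_def matrix_mul_minus_left matrix_mul_minus_right)
qed

lemma group_PSL2R: "group PSL2R"
  unfolding PSL2R_def by (rule normal.factorgroup_is_group) (rule normal_SL2R)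

definition upper_half_plane :: "complex set" where
  "upper_half_plane = {z. Im z > 0}"

definition mobius_act :: "real^2^2 \<Rightarrow> complex \<Rightarrow> complex" where
  "mobius_act A = moebius (of_real (A$1$1)) (of_real (A$1$2)) (of_real (A$2$1)) (of_real (A$2$2))"

definition hyp_dist :: "complex \<Rightarrow> complex \<Rightarrow> real" where
  "hyp_dist z w = arcosh (1 + (cmod (z - w))\<^sup>2 / (2 * Im z * Im w))"

text \<open>A subset of \<open>PSL2R\<close> is discrete in the quotient topology iff its preimage is
  discrete in \<open>SL2R\<close>.\<close>

definition fuchsian_group :: "(real^2^2) set set \<Rightarrow> bool" where
  "fuchsian_group \<Gamma> \<longleftrightarrow> subgroup \<Gamma> PSL2R \<and> discrete (\<Union>\<Gamma>)"

section \<open>The quotient surface\<close>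

definition orbit_of :: "(real^2^2) set set \<Rightarrow> complex \<Rightarrow> complex set" where
  "orbit_of \<Gamma> z = (\<lambda>A. mobius_act A z) ` \<Union>\<Gamma>"

definition quotient_surface :: "(real^2^2) set set \<Rightarrow> complex set set" where
  "quotient_surface \<Gamma> = orbit_of \<Gamma> ` upper_half_plane"

definition quotient_surface_topology :: "(real^2^2) set set \<Rightarrow> complex set topology" where
  "quotient_surface_topology \<Gamma> =
     topology (\<lambda>U. U \<subseteq> quotient_surface \<Gamma> \<and>
       openin (top_of_set upper_half_plane) {z \<in> upper_half_plane. orbit_of \<Gamma> z \<in> U})"

lemma openin_quotient_surface_topology:
  "openin (quotient_surface_topology \<Gamma>) U \<longleftrightarrow> U \<subseteq> quotient_surface \<Gamma> \<and>
     openin (top_of_set upper_half_plane) {z \<in> upper_half_plane. orbit_of \<Gamma> z \<in> U}"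
proof -
  let ?P = "\<lambda>U. {z \<in> upper_half_plane. orbit_of \<Gamma> z \<in> U}"
  have int: "?P (S \<inter> T) = ?P S \<inter> ?P T" for S T by auto
  have un: "?P (\<Union>K) = \<Union>(?P ` K)" for K by auto
  have "istopology (\<lambda>U. U \<subseteq> quotient_surface \<Gamma> \<and>
       openin (top_of_set upper_half_plane) (?P U))"
    unfolding istopology_def int un by (auto intro!: openin_Int openin_Union)
  then show ?thesis
    unfolding quotient_surface_topology_def by (simp add: topology_inverse')
qed

text \<open>For a Fuchsian group \<open>\<Gamma>\<close>, the quotient is a hyperbolic surface (a manifold with the
  projection a covering, rather than an orbifold with cone points) iff \<open>\<Gamma>\<close> acts freely. It is
  always connected, and always oriented, since \<open>PSL2R\<close> preserves the orientation of the
  half-plane.\<close>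

definition closed_hyperbolic_surface_group :: "(real^2^2) set set \<Rightarrow> bool" where
  "closed_hyperbolic_surface_group \<Gamma> \<longleftrightarrow> fuchsian_group \<Gamma> \<and>
     (\<forall>P\<in>\<Gamma>. \<forall>A\<in>P. \<forall>z\<in>upper_half_plane. mobius_act A z = z \<longrightarrow> P = \<one>\<^bsub>PSL2R\<^esub>) \<and>
     compact_space (quotient_surface_topology \<Gamma>)"

section \<open>Totally real number fields\<close>

abbreviation real_field :: "real ring" where
  "real_field \<equiv> ring_of_type_algebra"

abbreviation complex_field :: "complex ring" where
  "complex_field \<equiv> ring_of_type_algebra"

text \<open>Every totally real number field embeds into the reals, so it may be taken to be a subfield
  of the reals; the inclusion plays no special role among the embeddings.\<close>

definition totally_real_number_field :: "real set \<Rightarrow> bool" where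
  "totally_real_number_field F \<longleftrightarrow>
     subfield F real_field \<and> ring.finite_dimension real_field \<rat> F \<and>
     (\<forall>\<sigma> \<in> ring_hom (real_field\<lparr>carrier := F\<rparr>) complex_field. \<sigma> ` F \<subseteq> \<real>)"

definition real_places :: "real set \<Rightarrow> (real \<Rightarrow> real) set" where
  "real_places F = ring_hom (real_field\<lparr>carrier := F\<rparr>) real_field \<inter> extensional F"

definition ring_of_integers :: "real set \<Rightarrow> real set" where
  "ring_of_integers F = {x \<in> F. algebraic_int x}"

section \<open>Quaternion algebras and orders\<close>

text \<open>The tuple \<open>(x0, x1, x2, x3)\<close> stands for \<open>x0 + x1 i + x2 j + x3 k\<close> with
  \<open>i\<^sup>2 = a\<close>, \<open>j\<^sup>2 = b\<close>, \<open>i j = - j i = k\<close>. For nonzero \<open>a\<close>, \<open>b\<close> in a subfield \<open>F\<close>, the quaternion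
  algebra \<open>(a, b / F)\<close> is \<open>quat_points F\<close> with the product \<open>quat_mult a b\<close>.\<close>

type_synonym quat = "real \<times> real \<times> real \<times> real"

fun quat_mult :: "real \<Rightarrow> real \<Rightarrow> quat \<Rightarrow> quat \<Rightarrow> quat" where
  "quat_mult a b (x0, x1, x2, x3) (y0, y1, y2, y3) =
     (x0*y0 + a*x1*y1 + b*x2*y2 - a*b*x3*y3,
      x0*y1 + x1*y0 - b*x2*y3 + b*x3*y2,
      x0*y2 + x2*y0 + a*x1*y3 - a*x3*y1,
      x0*y3 + x3*y0 + x1*y2 - x2*y1)"

definition quat_one :: quat where
  "quat_one = (1, 0, 0, 0)"

fun quat_conj :: "quat \<Rightarrow> quat" where
  "quat_conj (x0, x1, x2, x3) = (x0, - x1, - x2, - x3)"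

fun quat_norm :: "real \<Rightarrow> real \<Rightarrow> quat \<Rightarrow> real" where
  "quat_norm a b (x0, x1, x2, x3) = x0\<^sup>2 - a*x1\<^sup>2 - b*x2\<^sup>2 + a*b*x3\<^sup>2"

lemma quat_mult_conj: "quat_mult a b x (quat_conj x) = quat_norm a b x *\<^sub>R quat_one"
  by (cases x) (simp add: quat_one_def power2_eq_square algebra_simps)

lemma quat_mult_assoc:
  "quat_mult a b (quat_mult a b x y) z = quat_mult a b x (quat_mult a b y z)"
  by (cases x; cases y; cases z) (simp add: algebra_simps)

fun quat_map :: "(real \<Rightarrow> real) \<Rightarrow> quat \<Rightarrow> quat" where
  "quat_map \<sigma> (x0, x1, x2, x3) = (\<sigma> x0, \<sigma> x1, \<sigma> x2, \<sigma> x3)"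

definition quat_points :: "real set \<Rightarrow> quat set" where
  "quat_points F = F \<times> F \<times> F \<times> F"

text \<open>Isomorphisms of real algebras from \<open>(a, b / R)\<close> to the 2 by 2 real matrices.\<close>

definition quat_matrix_iso :: "real \<Rightarrow> real \<Rightarrow> (quat \<Rightarrow> real^2^2) \<Rightarrow> bool" where
  "quat_matrix_iso a b \<phi> \<longleftrightarrow> linear \<phi> \<and> bij \<phi> \<and> \<phi> quat_one = mat 1 \<and>
     (\<forall>x y. \<phi> (quat_mult a b x y) = \<phi> x ** \<phi> y)"

text \<open>Extending scalars along \<open>\<sigma>\<close> turns \<open>(a, b / F)\<close> into \<open>(\<sigma> a, \<sigma> b / R)\<close>.\<close>

definition split_at :: "real \<Rightarrow> real \<Rightarrow> (real \<Rightarrow> real) \<Rightarrow> bool" where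
  "split_at a b \<sigma> \<longleftrightarrow> (\<exists>\<phi>. quat_matrix_iso (\<sigma> a) (\<sigma> b) \<phi>)"

definition combinations :: "real set \<Rightarrow> quat set \<Rightarrow> quat set" where
  "combinations S B = {\<Sum>x\<in>B. c x *\<^sub>R x | c. \<forall>x\<in>B. c x \<in> S}"

text \<open>An order is a subring that is a complete lattice, i.e. a finitely generated module over the
  ring of integers that spans the algebra over \<open>F\<close>.\<close>

definition quat_order :: "real set \<Rightarrow> real \<Rightarrow> real \<Rightarrow> quat set \<Rightarrow> bool" where
  "quat_order F a b R \<longleftrightarrow> quat_one \<in> R \<and> (\<forall>x\<in>R. \<forall>y\<in>R. quat_mult a b x y \<in> R) \<and>
     (\<exists>B. finite B \<and> R = combinations (ring_of_integers F) B \<and>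
          quat_points F = combinations F B)"

definition norm_one_units :: "real \<Rightarrow> real \<Rightarrow> quat set \<Rightarrow> quat set" where
  "norm_one_units a b R = {x \<in> R. quat_norm a b x = 1 \<and>
     (\<exists>y\<in>R. quat_mult a b x y = quat_one \<and> quat_mult a b y x = quat_one)}"

section \<open>Arithmetic Fuchsian groups\<close>

definition commensurable :: "('a, 'b) monoid_scheme \<Rightarrow> 'a set \<Rightarrow> 'a set \<Rightarrow> bool" where
  "commensurable G H K \<longleftrightarrow>
     finite (rcosets\<^bsub>G\<lparr>carrier := H\<rparr>\<^esub> (H \<inter> K)) \<and> finite (rcosets\<^bsub>G\<lparr>carrier := K\<rparr>\<^esub> (H \<inter> K))"

definition arithmetic_fuchsian_group :: "(real^2^2) set set \<Rightarrow> bool" where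
  "arithmetic_fuchsian_group \<Gamma> \<longleftrightarrow> fuchsian_group \<Gamma> \<and>
     (\<exists>F a b \<sigma> R \<phi>. totally_real_number_field F \<and> a \<in> F - {0} \<and> b \<in> F - {0} \<and>
        {\<tau> \<in> real_places F. split_at a b \<tau>} = {\<sigma>} \<and>
        quat_order F a b R \<and> quat_matrix_iso (\<sigma> a) (\<sigma> b) \<phi> \<and>
        (\<exists>g\<in>carrier PSL2R. commensurable PSL2R
           (g <#\<^bsub>PSL2R\<^esub> \<Gamma> #>\<^bsub>PSL2R\<^esub> (inv\<^bsub>PSL2R\<^esub> g))
           ((\<lambda>x. {mat 1, - mat 1} #>\<^bsub>SL2R\<^esub> \<phi> (quat_map \<sigma> x)) ` norm_one_units a b R)))"

section \<open>Closed geodesics\<close>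

definition geodesic_line :: "(real \<Rightarrow> complex) \<Rightarrow> bool" where
  "geodesic_line \<gamma> \<longleftrightarrow> range \<gamma> \<subseteq> upper_half_plane \<and> (\<forall>s t. hyp_dist (\<gamma> s) (\<gamma> t) = \<bar>s - t\<bar>)"

text \<open>The unit speed geodesics of the quotient are the projections of the geodesic lines. A closed
  geodesic is such a curve \<open>c\<close> together with a period \<open>L\<close>, and stands for the restriction of
  \<open>c\<close> to \<open>[0, L]\<close>; it is primitive if it is not a proper iterate of a closed geodesic.\<close>

definition closed_geodesic :: "(real^2^2) set set \<Rightarrow> (real \<Rightarrow> complex set) \<Rightarrow> real \<Rightarrow> bool" where
  "closed_geodesic \<Gamma> c L \<longleftrightarrow> L > 0 \<and>
     (\<exists>\<gamma>. geodesic_line \<gamma> \<and> c = (\<lambda>t. orbit_of \<Gamma> (\<gamma> t))) \<and> (\<forall>t. c (t + L) = c t)"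

definition primitive_closed_geodesic ::
    "(real^2^2) set set \<Rightarrow> (real \<Rightarrow> complex set) \<Rightarrow> real \<Rightarrow> bool" where
  "primitive_closed_geodesic \<Gamma> c L \<longleftrightarrow>
     closed_geodesic \<Gamma> c L \<and> \<not> (\<exists>n::nat. n \<ge> 2 \<and> closed_geodesic \<Gamma> c (L / real n))"

text \<open>Angles lie in \<open>]0,\<pi>[\<close>, so geodesics are unoriented: a primitive closed geodesic is a class
  of curves modulo change of base point and orientation (the length \<open>L\<close> is determined by the
  curve as its least period).\<close>

definition primitive_closed_geodesics :: "(real^2^2) set set \<Rightarrow> (real \<Rightarrow> complex set) set set" where
  "primitive_closed_geodesics \<Gamma> =
     {{\<lambda>t. c (\<epsilon> * t + s) | \<epsilon> s. \<epsilon> \<in> {1, - 1}} | c. \<exists>L. primitive_closed_geodesic \<Gamma> c L}"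

text \<open>A geodesic \<open>\<alpha>\<close> may pass several times through \<open>z\<close>. A passage is recorded by the
  parametrisations of \<open>\<alpha>\<close> that perform it at time 0.\<close>

definition passages ::
    "(real \<Rightarrow> complex set) set \<Rightarrow> complex set \<Rightarrow> (real \<Rightarrow> complex set) set set" where
  "passages \<alpha> z = {{c, \<lambda>t. c (- t)} | c. c \<in> \<alpha> \<and> c 0 = z}"

section \<open>Angles\<close>

text \<open>Counter-clockwise angle from the line spanned by \<open>u\<close> to the line spanned by \<open>v\<close>.\<close>

definition ccw_line_angle :: "complex \<Rightarrow> complex \<Rightarrow> real \<Rightarrow> bool" where
  "ccw_line_angle u v \<theta> \<longleftrightarrow> 0 < \<theta> \<and> \<theta> < pi \<and> u \<noteq> 0 \<and>
     (\<exists>r::real. r \<noteq> 0 \<and> v = of_real r * cis \<theta> * u)"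

text \<open>The angle from one passage to another through the same point is measured in the half-plane,
  after lifting both through a common point: the hyperbolic metric is conformal to the Euclidean
  one, and the projection is a local isometry preserving orientation. The passages meet
  transversely iff this angle exists.\<close>

definition passage_angle ::
    "(real^2^2) set set \<Rightarrow> (real \<Rightarrow> complex set) set \<Rightarrow> (real \<Rightarrow> complex set) set \<Rightarrow> real \<Rightarrow> bool" where
  "passage_angle \<Gamma> p q \<theta> \<longleftrightarrow>
     (\<exists>\<gamma> \<delta> u v. geodesic_line \<gamma> \<and> geodesic_line \<delta> \<and>
        (\<lambda>t. orbit_of \<Gamma> (\<gamma> t)) \<in> p \<and> (\<lambda>t. orbit_of \<Gamma> (\<delta> t)) \<in> q \<and> \<gamma> 0 = \<delta> 0 \<and>
        (\<gamma> has_vector_derivative u) (at 0) \<and> (\<delta> has_vector_derivative v) (at 0) \<and>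
        ccw_line_angle u v \<theta>)"

text \<open>The transverse intersections of ordered pairs \<open>(\<alpha>, \<beta>)\<close> with angle \<open>\<theta>\<close> from \<open>\<alpha>\<close> to \<open>\<beta>\<close>. The
  passages \<open>p\<close>, \<open>q\<close> distinguish the intersections at a common point when \<open>\<alpha>\<close> or \<open>\<beta>\<close> passes several
  times through it. The multiplicity of \<open>\<theta>\<close> is the cardinality of this set.\<close>

definition intersections_with_angle :: "(real^2^2) set set \<Rightarrow> real \<Rightarrow>
    ((real \<Rightarrow> complex set) set \<times> (real \<Rightarrow> complex set) set \<times> complex set \<times>
     (real \<Rightarrow> complex set) set \<times> (real \<Rightarrow> complex set) set) set" where
  "intersections_with_angle \<Gamma> \<theta> =
     {(\<alpha>, \<beta>, z, p, q). \<alpha> \<in> primitive_closed_geodesics \<Gamma> \<and> \<beta> \<in> primitive_closed_geodesics \<Gamma> \<and>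
        z \<in> quotient_surface \<Gamma> \<and> p \<in> passages \<alpha> z \<and> q \<in> passages \<beta> z \<and> passage_angle \<Gamma> p q \<theta>}"

definition angle_spectrum :: "(real^2^2) set set \<Rightarrow> real set" where
  "angle_spectrum \<Gamma> = {\<theta>. intersections_with_angle \<Gamma> \<theta> \<noteq> {}}"

end

theory Submission
  imports Defs
begin

text \<open>Lift an intersection of angle \<open>\<theta>\<close> to two geodesic lines through a point \<open>w\<close>, each of them
  translated by some element of \<open>\<Gamma>\<close>. If \<open>Y\<close> commensurates \<open>\<Gamma>\<close>, then the images of the lines under \<open>Y\<close>
  again project to closed geodesics, and they meet at \<open>Y w\<close> with the same angle. By arithmeticity one
  may take \<open>Y = 1 + q N\<close> for small rational \<open>q\<close>, where \<open>N\<close> is conjugate to the image of one of the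
  quaternions \<open>i\<close>, \<open>j\<close>, \<open>k\<close> and does not fix \<open>w\<close>. The points \<open>Y w\<close> are then infinitely many points of
  a compact set, and discreteness of \<open>\<Gamma>\<close> makes them fall into infinitely many orbits.

  To see that \<open>Y\<close> commensurates, it suffices to treat one norm-one unit \<open>u\<close> of trace \<open>t\<close>: its conjugate
  \<open>v\<close> by \<open>Y\<close> satisfies \<open>v\<^sup>2 = t v - 1\<close>, so \<open>v\<^sup>k = U\<^sub>k v - U\<^sub>k\<^sub>-\<^sub>1\<close> with \<open>U\<^sub>k\<close> in \<open>\<int>[t]\<close>, and since
  \<open>\<int>[t]/n\<close> is finite, \<open>v\<^sup>k\<close> is congruent to 1 modulo a denominator \<open>n\<close> of \<open>v\<close> for some \<open>k > 0\<close>.\<close>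

text \<open>Commensuration is used only elementwise: for each \<open>A\<close> in the group some
  power \<open>A^k\<close>, with \<open>k\<close> depending on \<open>A\<close>, is conjugated by
  \<open>Y\<close> back into the group. That is all a closed geodesic needs, because a lift
  translated by \<open>A\<close> is also translated by \<open>A^k\<close>. It replaces finiteness of
  the order modulo \<open>n\<close>, which rests on finiteness of the ring of integers modulo
  \<open>n\<close>, by a statement about one algebraic number \<open>t\<close>. The parameter
  \<open>q\<close> is rational because every real place fixes the rationals: the coordinates of
  \<open>1 + q i\<close> survive the passage from \<open>F\<close> to the reals through
  \<open>\<sigma>\<close>, so the matrix \<open>Y\<close> depends continuously on \<open>q\<close>.
  A general element of \<open>F\<close> would be moved by \<open>\<sigma>\<close> without control.
  The definition of a closed geodesic compares orbits time by time and provides no deck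
  transformation. One group element translating a whole lift is found by counting: uncountably many
  times against a countable group force one element to serve two times, and a geodesic line is
  determined by its positions at two times.\<close>

no_notation fps_nth (infixl \<open>$\<close> 75)

section \<open>Moebius transformations of the half-plane\<close>

text \<open>The automorphy factor \<open>c z + d\<close>, through which differences, imaginary parts
  and derivatives transform.\<close>

definition mobius_denom :: "real^2^2 \<Rightarrow> complex \<Rightarrow> complex" where
  "mobius_denom A z = of_real (A$2$1) * z + of_real (A$2$2)"

lemma mobius_act_eq:
  "mobius_act A z = (of_real (A$1$1) * z + of_real (A$1$2)) / mobius_denom A z"
  by (simp add: mobius_act_def moebius_def mobius_denom_def)

lemma mobius_denom_nonzero:
  assumes "det A \<noteq> 0" "Im z > 0"
  shows "mobius_denom A z \<noteq> 0"
proof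
  assume "mobius_denom A z = 0"
  then have "A$2$1 * Im z = 0" "A$2$1 * Re z + A$2$2 = 0"
    by (auto simp: mobius_denom_def complex_eq_iff)
  with assms show False by (auto simp: det_2)
qed

lemma mobius_act_diff:
  assumes "det A \<noteq> 0" "Im z > 0" "Im w > 0"
  shows "mobius_act A z - mobius_act A w =
    of_real (det A) * (z - w) / (mobius_denom A z * mobius_denom A w)"
  using mobius_denom_nonzero[OF assms(1,2)] mobius_denom_nonzero[OF assms(1,3)]
  by (simp add: mobius_act_eq field_simps) (simp add: mobius_denom_def det_2 algebra_simps)

lemma Im_mobius_act:
  assumes "det A \<noteq> 0" "Im z > 0"
  shows "Im (mobius_act A z) = det A * Im z / (cmod (mobius_denom A z))\<^sup>2"
proof -
  have "Im (mobius_act A z) = (Im ((of_real (A$1$1) * z + of_real (A$1$2)) * cnj (mobius_denom A z)))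
     / (cmod (mobius_denom A z))\<^sup>2"
    by (simp only: mobius_act_eq complex_div_cnj[of _ "mobius_denom A z"] Im_divide_of_real)
  also have "Im ((of_real (A$1$1) * z + of_real (A$1$2)) * cnj (mobius_denom A z)) = det A * Im z"
    by (simp add: mobius_denom_def det_2 algebra_simps)
  finally show ?thesis .
qed

lemma Im_mobius_act_pos:
  assumes "det A > 0" "Im z > 0"
  shows "Im (mobius_act A z) > 0"
  using assms Im_mobius_act[of A z] mobius_denom_nonzero[of A z] by simp

lemma mobius_act_mult:
  assumes "det B > 0" "Im z > 0"
  shows "mobius_act (A ** B) z = mobius_act A (mobius_act B z)"
proof -
  have nz: "mobius_denom B z \<noteq> 0" using assms by (intro mobius_denom_nonzero) auto
  let ?f = "\<lambda>(A :: real^2^2) i z. of_real (A$i$1) * z + of_real (A$i$2) :: complex"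
  have 1: "mobius_act (A ** B) z = ?f (A ** B) 1 z / ?f (A ** B) 2 z"
    by (simp add: mobius_act_eq mobius_denom_def)
  have 2: "?f (A ** B) i z = ?f A i (mobius_act B z) * mobius_denom B z" for i
  proof -
    have "mobius_act B z * mobius_denom B z = ?f B 1 z"
      using nz by (simp add: mobius_act_eq)
    then show ?thesis
      by (simp add: distrib_right mult.assoc)
        (simp add: mobius_denom_def matrix_matrix_mult_def sum_2 algebra_simps)
  qed
  show ?thesis
    unfolding 1 2 using nz by (simp add: mobius_act_eq[of A] mobius_denom_def[of A])
qed

lemma mobius_act_one [simp]: "mobius_act (mat 1) z = z"
  by (simp add: mobius_act_eq mobius_denom_def mat_def)

lemma has_field_derivative_mobius_act:
  assumes "det A \<noteq> 0" "Im z > 0"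
  shows "(mobius_act A has_field_derivative of_real (det A) / (mobius_denom A z)\<^sup>2) (at z)"
proof -
  have nz: "mobius_denom A z \<noteq> 0" using assms by (rule mobius_denom_nonzero)
  have "((\<lambda>z. (of_real (A$1$1) * z + of_real (A$1$2)) / mobius_denom A z) has_field_derivative
     (of_real (A$1$1) * mobius_denom A z - (of_real (A$1$1) * z + of_real (A$1$2)) * of_real (A$2$1))
      / (mobius_denom A z * mobius_denom A z)) (at z)"
    using nz unfolding mobius_denom_def by (auto intro!: derivative_eq_intros)
  moreover have "of_real (A$1$1) * mobius_denom A z - (of_real (A$1$1) * z + of_real (A$1$2)) * of_real (A$2$1)
     = complex_of_real (det A)"
    by (simp add: mobius_denom_def det_2 algebra_simps)
  ultimately show ?thesis
    by (simp add: mobius_act_eq[abs_def] power2_eq_square)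
qed

text \<open>The squared Euclidean distance and the product of the imaginary parts acquire the same
  factor, the square of \<open>det A\<close> over the squared moduli of both automorphy factors.
  Positive determinants are allowed because the commensurating matrices are not normalised to
  determinant 1.\<close>

lemma hyp_dist_mobius_act:
  assumes "det A > 0" "Im z > 0" "Im w > 0"
  shows "hyp_dist (mobius_act A z) (mobius_act A w) = hyp_dist z w"
proof -
  have nz: "mobius_denom A z \<noteq> 0" "mobius_denom A w \<noteq> 0"
    using assms mobius_denom_nonzero[of A z] mobius_denom_nonzero[of A w] by auto
  have "(cmod (mobius_act A z - mobius_act A w))\<^sup>2 / (2 * Im (mobius_act A z) * Im (mobius_act A w))
      = (cmod (z - w))\<^sup>2 / (2 * Im z * Im w)"
    using assms nz
    by (simp add: mobius_act_diff Im_mobius_act norm_divide norm_mult power_divide power_mult_distrib)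
       (simp add: field_simps power2_eq_square)
  then show ?thesis by (simp add: hyp_dist_def)
qed

lemma geodesic_line_mobius_act:
  assumes "det A > 0" "geodesic_line \<gamma>"
  shows "geodesic_line (\<lambda>t. mobius_act A (\<gamma> t))"
proof -
  have "Im (\<gamma> t) > 0" for t using assms(2) by (auto simp: geodesic_line_def upper_half_plane_def)
  with assms show ?thesis
    by (auto simp: geodesic_line_def upper_half_plane_def Im_mobius_act_pos hyp_dist_mobius_act)
qed

lemma Im_geodesic_line: "geodesic_line \<gamma> \<Longrightarrow> Im (\<gamma> t) > 0"
  by (auto simp: geodesic_line_def upper_half_plane_def)

section \<open>Rigidity of geodesic lines\<close>

text \<open>Polarisation of \<open>a c - b\<^sup>2\<close>, a form of signature (1,2). In this
  hyperboloid model geodesics have a linear description, so rigidity of distance-preserving curves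
  becomes linear algebra.\<close>

definition lorentz :: "real \<times> real \<times> real \<Rightarrow> real \<times> real \<times> real \<Rightarrow> real" where
  "lorentz = (\<lambda>(a, b, c) (a', b', c'). (a * c' + c * a') / 2 - b * b')"

text \<open>The coefficients of the quadratic polynomial \<open>a X\<^sup>2 - 2 b X + c\<close> with
  root \<open>z\<close>, normalised by \<open>a c - b\<^sup>2 = 1\<close>.\<close>

definition hyperboloid_point :: "complex \<Rightarrow> real \<times> real \<times> real" where
  "hyperboloid_point z = (1 / Im z, Re z / Im z, (cmod z)\<^sup>2 / Im z)"

lemma lorentz_hyperboloid_point:
  assumes "Im z > 0" "Im w > 0"
  shows "lorentz (hyperboloid_point z) (hyperboloid_point w) = cosh (hyp_dist z w)"
proof -
  have "cosh (hyp_dist z w) = 1 + (cmod (z - w))\<^sup>2 / (2 * Im z * Im w)"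
    using assms unfolding hyp_dist_def by (intro cosh_arcosh_real) simp
  also have "\<dots> = ((cmod (z - w))\<^sup>2 + 2 * Im z * Im w) / (2 * Im z * Im w)"
    using assms by (simp add: add_divide_distrib)
  also have "(cmod (z - w))\<^sup>2 + 2 * Im z * Im w = (cmod z)\<^sup>2 + (cmod w)\<^sup>2 - 2 * Re z * Re w"
    unfolding cmod_power2 by (simp add: power2_eq_square algebra_simps)
  also have "\<dots> / (2 * Im z * Im w) = lorentz (hyperboloid_point z) (hyperboloid_point w)"
    using assms by (simp add: lorentz_def hyperboloid_point_def add_divide_distrib diff_divide_distrib mult_ac)
  finally show ?thesis ..
qed

lemma hyperboloid_point_inj:
  assumes "Im z > 0" "Im w > 0" "hyperboloid_point z = hyperboloid_point w"
  shows "z = w"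
  using assms by (auto simp: hyperboloid_point_def complex_eq_iff)

lemma lorentz_linear:
  "lorentz (x + y) z = lorentz x z + lorentz y z"
  "lorentz (x - y) z = lorentz x z - lorentz y z"
  "lorentz (r *\<^sub>R x) z = r * lorentz x z"
  "lorentz z (x + y) = lorentz z x + lorentz z y"
  "lorentz z (x - y) = lorentz z x - lorentz z y"
  "lorentz z (r *\<^sub>R x) = r * lorentz z x"
  by (cases x; cases y; cases z; simp add: lorentz_def field_simps)+

lemma lorentz_commute: "lorentz x y = lorentz y x"
  by (cases x; cases y) (simp add: lorentz_def)

text \<open>The orthogonal complement of a timelike vector is negative definite. The sum of two
  squares in the proof makes this explicit.\<close>

lemma null_vector_orthogonal_to_timelike:
  assumes "lorentz x x = 0" "lorentz x (hyperboloid_point z) = 0" "Im z > 0"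
  shows "x = 0"
proof -
  obtain a b c where x: "x = (a, b, c)" by (cases x) auto
  have 1: "a * c = b\<^sup>2" using assms(1) by (simp add: x lorentz_def power2_eq_square)
  have 2: "a * (cmod z)\<^sup>2 + c = 2 * b * Re z" 
    using assms(2,3) by (simp add: x lorentz_def hyperboloid_point_def field_simps)
  have "(a * Re z - b)\<^sup>2 + (a * Im z)\<^sup>2 = a * (a * (cmod z)\<^sup>2 + c - 2 * b * Re z) - (a * c - b\<^sup>2)"
    unfolding cmod_power2 by (simp add: power2_eq_square algebra_simps)
  then have "(a * Re z - b)\<^sup>2 + (a * Im z)\<^sup>2 = 0" using 1 2 by simp
  then have "a * Im z = 0" "a * Re z - b = 0" by (auto simp: sum_power2_eq_zero_iff)
  with assms(3) 2 show ?thesis by (auto simp: x zero_prod_def)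
qed

text \<open>The pairs \<open>(p, P)\<close> and \<open>(q, Q)\<close> will be the sinh and cosh of
  \<open>r - t\<close> and \<open>t - s\<close>, in either order.\<close>

lemma hyperbolic_addition_aux:
  fixes p P q Q :: real
  assumes "Q\<^sup>2 = q\<^sup>2 + 1"
  shows "p + q * (P * Q + p * q) = Q * (p * Q + P * q)"
proof -
  have "Q * (p * Q + P * q) - q * (P * Q + p * q) = p * (Q\<^sup>2 - q\<^sup>2)"
    by (simp add: power2_eq_square algebra_simps)
  then show ?thesis using assms by simp
qed

text \<open>The right-hand side \<open>W\<close> is the point predicted by the hyperbolic law of
  interpolation. The difference between actual and predicted point is orthogonal to the points at
  times \<open>s\<close> and \<open>r\<close>, hence to \<open>W\<close>; it turns out to be null as
  well, and so vanishes.\<close>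

lemma hyperboloid_point_geodesic_line:
  assumes \<gamma>: "geodesic_line \<gamma>" and "s \<noteq> r"
  shows "hyperboloid_point (\<gamma> t) =
    (sinh (r - t) / sinh (r - s)) *\<^sub>R hyperboloid_point (\<gamma> s) +
    (sinh (t - s) / sinh (r - s)) *\<^sub>R hyperboloid_point (\<gamma> r)"
proof -
  let ?V = "\<lambda>t. hyperboloid_point (\<gamma> t)"
  have B: "lorentz (?V x) (?V y) = cosh (x - y)" for x y
    using \<gamma> lorentz_hyperboloid_point[of "\<gamma> x" "\<gamma> y"] Im_geodesic_line[OF \<gamma>]
    by (simp add: geodesic_line_def)
  have nz: "sinh (r - s) \<noteq> 0" using assms(2) by simp
  define W where "W = (sinh (r - t) / sinh (r - s)) *\<^sub>R ?V s + (sinh (t - s) / sinh (r - s)) *\<^sub>R ?V r"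
  have c: "cosh (s - t) = cosh (t - s)" "cosh (s - r) = cosh (r - s)" "cosh (t - r) = cosh (r - t)"
    by (metis cosh_minus minus_diff_eq)+
  have sa: "sinh (r - t) * cosh (t - s) + cosh (r - t) * sinh (t - s) = sinh (r - s)"
    using sinh_add[of "r - t" "t - s"] by simp
  have ca: "cosh (r - t) * cosh (t - s) + sinh (r - t) * sinh (t - s) = cosh (r - s)"
    using cosh_add[of "r - t" "t - s"] by simp
  have sq: "(cosh (t - s))\<^sup>2 = (sinh (t - s))\<^sup>2 + 1" "(cosh (r - t))\<^sup>2 = (sinh (r - t))\<^sup>2 + 1"
    by (simp_all add: cosh_square_eq)
  have Ws: "lorentz (?V t - W) (?V s) = 0"
  proof -
    have "sinh (r - t) + sinh (t - s) * cosh (r - s) = cosh (t - s) * sinh (r - s)"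
      unfolding sa[symmetric] ca[symmetric] using hyperbolic_addition_aux[OF sq(1)] .
    then show ?thesis using nz by (simp add: W_def lorentz_linear B c field_simps)
  qed
  have Wr: "lorentz (?V t - W) (?V r) = 0"
  proof -
    have "sinh (r - t) * cosh (r - s) + sinh (t - s) = cosh (r - t) * sinh (r - s)"
      unfolding sa[symmetric] ca[symmetric]
      using hyperbolic_addition_aux[OF sq(2), of "sinh (t - s)" "cosh (t - s)"]
      by (simp add: algebra_simps)
    then show ?thesis using nz by (simp add: W_def lorentz_linear B c field_simps)
  qed
  have WW: "lorentz (?V t - W) W = 0"
    by (subst W_def) (use Ws Wr in \<open>simp add: lorentz_linear\<close>)
  \<comment> \<open>The value 1 is also the pairing of the actual point with itself, so the
    difference is orthogonal to the actual point too.\<close>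
  have "lorentz (?V t) W =
      (sinh (r - t) * cosh (t - s) + sinh (t - s) * cosh (t - r)) / sinh (r - s)"
    by (simp add: W_def lorentz_linear B add_divide_distrib)
  also have "\<dots> = 1"
    unfolding c(3) using sa nz by (simp add: mult.commute)
  finally have "lorentz (?V t) W = 1" .
  then have "lorentz (?V t - W) (?V t) = 0"
    by (simp add: lorentz_linear B lorentz_commute[of W])
  then have "lorentz (?V t - W) (?V t - W) = 0"
    using WW lorentz_linear(5)[of "?V t - W" "?V t" W] by simp
  then have "?V t - W = 0"
    using Ws Im_geodesic_line[OF \<gamma>] by (rule null_vector_orthogonal_to_timelike)
  then show ?thesis by (simp add: W_def)
qed

lemma geodesic_line_eqI:
  assumes "geodesic_line \<gamma>" "geodesic_line \<delta>" "s \<noteq> r" "\<gamma> s = \<delta> s" "\<gamma> r = \<delta> r"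
  shows "\<gamma> = \<delta>"
proof
  fix t
  show "\<gamma> t = \<delta> t"
  proof (rule hyperboloid_point_inj)
    show "Im (\<gamma> t) > 0" "Im (\<delta> t) > 0"
      using assms(1,2) by (auto intro: Im_geodesic_line)
    show "hyperboloid_point (\<gamma> t) = hyperboloid_point (\<delta> t)"
      unfolding hyperboloid_point_geodesic_line[OF assms(1,3), of t]
        hyperboloid_point_geodesic_line[OF assms(2,3), of t] assms(4,5) ..
  qed
qed

lemma inj_geodesic_line:
  assumes "geodesic_line \<gamma>"
  shows "inj \<gamma>"
proof (rule injI)
  fix s t assume "\<gamma> s = \<gamma> t"
  then have "\<bar>s - t\<bar> = hyp_dist (\<gamma> t) (\<gamma> t)" using assms by (metis geodesic_line_def)
  then show "s = t" by (simp add: hyp_dist_def)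
qed

text \<open>Reading continuity off the interpolation formula with base times 0 and 1 avoids
  comparing \<open>hyp_dist\<close> with the Euclidean topology. The first two coordinates of
  \<open>hyperboloid_point\<close> recover the point.\<close>

lemma continuous_on_geodesic_line:
  assumes "geodesic_line \<gamma>"
  shows "continuous_on S \<gamma>"
proof -
  let ?V = "\<lambda>t. hyperboloid_point (\<gamma> t)"
  have eq: "?V = (\<lambda>t. (sinh (1 - t) / sinh 1) *\<^sub>R ?V 0 + (sinh t / sinh 1) *\<^sub>R ?V 1)"
  proof
    fix t
    show "?V t = (sinh (1 - t) / sinh 1) *\<^sub>R ?V 0 + (sinh t / sinh 1) *\<^sub>R ?V 1"
      using hyperboloid_point_geodesic_line[OF assms, of 0 1 t] by (simp only: diff_zero)
  qed
  have "continuous_on S (\<lambda>t::real. (sinh (1 - t) / sinh 1) *\<^sub>R a + (sinh t / sinh 1) *\<^sub>R b)"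
    for a b :: "real \<times> real \<times> real"
    unfolding sinh_def by (intro continuous_intros) auto
  then have V: "continuous_on S ?V" by (subst eq)
  have Im: "Im (\<gamma> t) > 0" for t using assms by (rule Im_geodesic_line)
  then have "fst (?V t) \<noteq> 0" for t by (simp add: hyperboloid_point_def less_imp_neq[symmetric])
  then have "continuous_on S (\<lambda>t. Complex (fst (snd (?V t)) / fst (?V t)) (1 / fst (?V t)))"
    using V by (intro continuous_on_Complex continuous_intros) auto
  moreover have "Complex (fst (snd (?V t)) / fst (?V t)) (1 / fst (?V t)) = \<gamma> t" for t
    using Im[of t] by (simp add: hyperboloid_point_def complex_eq_iff)
  ultimately show ?thesis by simp
qed

lemma geodesic_line_shift:
  assumes "geodesic_line \<gamma>"
  shows "geodesic_line (\<lambda>t. \<gamma> (t + s))"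
  using assms by (auto simp: geodesic_line_def)

section \<open>Discrete groups\<close>

text \<open>The inverse of a matrix of determinant 1, written by Cayley-Hamilton as a linear
  expression in the entries, so that limits pass through it.\<close>

definition adjugate :: "real^2^2 \<Rightarrow> real^2^2" where
  "adjugate A = (A$1$1 + A$2$2) *\<^sub>R mat 1 - A"

lemma adjugate_mult: "adjugate A ** A = det A *\<^sub>R mat 1" "A ** adjugate A = det A *\<^sub>R mat 1"
  by (simp_all add: adjugate_def vec_eq_iff forall_2 matrix_matrix_mult_def sum_2 mat_def det_2 algebra_simps)

text \<open>As \<open>z\<close> is not real, the imaginary part alone controls \<open>a\<close>; the
  triangle inequality then controls \<open>b\<close>.\<close>

lemma coefficients_bounded:
  assumes "Im z > 0" "cmod (of_real a * z + of_real b) \<le> M"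
  shows "\<bar>a\<bar> \<le> M / Im z" "\<bar>b\<bar> \<le> M + M / Im z * cmod z"
proof -
  have "\<bar>a\<bar> * Im z = \<bar>Im (of_real a * z + of_real b)\<bar>" using assms(1) by (simp add: abs_mult)
  also have "\<dots> \<le> M" using assms(2) abs_Im_le_cmod order_trans by blast
  finally show a: "\<bar>a\<bar> \<le> M / Im z" using assms(1) by (simp add: field_simps)
  have "cmod (of_real b) \<le> cmod (of_real a * z + of_real b) + cmod (of_real a * z)"
    by (metis add_diff_cancel_left' norm_triangle_ineq4)
  also have "\<dots> \<le> M + M / Im z * cmod z"
    using assms(2) mult_right_mono[OF a norm_ge_zero[of z]]
    by (intro add_mono) (auto simp: norm_mult)
  finally show "\<bar>b\<bar> \<le> M + M / Im z * cmod z" by simp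
qed

text \<open>Everything is phrased for the preimage in \<open>SL2R\<close>, where norms, limits and
  the Moebius action apply to matrices directly instead of to cosets.\<close>

locale discrete_matrix_group =
  fixes \<Gamma> :: "(real^2^2) set set"
  assumes det_eq_1: "A \<in> \<Union>\<Gamma> \<Longrightarrow> det A = 1"
    and one_mem: "mat 1 \<in> \<Union>\<Gamma>"
    and mult_mem: "A \<in> \<Union>\<Gamma> \<Longrightarrow> B \<in> \<Union>\<Gamma> \<Longrightarrow> A ** B \<in> \<Union>\<Gamma>"
    and inverse_ex: "A \<in> \<Union>\<Gamma> \<Longrightarrow> \<exists>B\<in>\<Union>\<Gamma>. A ** B = mat 1 \<and> B ** A = mat 1"
    and discrete: "discrete (\<Union>\<Gamma>)"
begin

lemma adjugate_mem: "A \<in> \<Union>\<Gamma> \<Longrightarrow> adjugate A \<in> \<Union>\<Gamma>"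
proof -
  assume A: "A \<in> \<Union>\<Gamma>"
  then obtain B where B: "B \<in> \<Union>\<Gamma>" "A ** B = mat 1" using inverse_ex by blast
  have "adjugate A = adjugate A ** (A ** B)" using B by simp
  also have "\<dots> = B" unfolding matrix_mul_assoc adjugate_mult det_eq_1[OF A] by simp
  finally show ?thesis using B by simp
qed

text \<open>For a convergent sequence of group elements the quotients of consecutive terms tend to
  1. Isolation of 1 makes these quotients equal to 1 eventually, so the sequence is eventually
  constant.\<close>

lemma closed_group: "closed (\<Union>\<Gamma>)"
  unfolding closed_sequential_limits
proof (intro allI impI, elim conjE)
  fix x l assume x: "\<forall>n. x n \<in> \<Union>\<Gamma>" and lim: "x \<longlonglongrightarrow> l"
  obtain e where e: "e > 0" "\<And>A. A \<in> \<Union>\<Gamma> \<Longrightarrow> dist (mat 1) A < e \<Longrightarrow> A = mat 1"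
    using discrete one_mem unfolding discrete_def isolated_in_dist_Ex_iff by metis
  have lim': "(\<lambda>n. x (Suc n)) \<longlonglongrightarrow> l" using lim by (rule LIMSEQ_Suc)
  have "(\<lambda>n. det (x n)) \<longlonglongrightarrow> det l"
    unfolding det_2 by (intro tendsto_intros lim)
  moreover have "det (x n) = 1" for n using x det_eq_1 by blast
  ultimately have "det l = 1" by (simp add: LIMSEQ_const_iff)
  have "(\<lambda>n. adjugate (x n) ** x (Suc n)) \<longlonglongrightarrow> adjugate l ** l"
    unfolding matrix_matrix_mult_def adjugate_def by (intro tendsto_intros lim lim')
  then have "(\<lambda>n. adjugate (x n) ** x (Suc n)) \<longlonglongrightarrow> mat 1"
    by (simp add: adjugate_mult \<open>det l = 1\<close>)
  from tendstoD[OF this e(1)] obtain N where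
    N: "\<And>n. n \<ge> N \<Longrightarrow> dist (adjugate (x n) ** x (Suc n)) (mat 1) < e"
    unfolding eventually_sequentially by blast
  have step: "x (Suc n) = x n" if "n \<ge> N" for n
  proof -
    have "adjugate (x n) ** x (Suc n) = mat 1"
      using N[OF that] x by (intro e) (auto simp: dist_commute intro!: mult_mem adjugate_mem simp del: Union_iff)
    then have "x n ** (adjugate (x n) ** x (Suc n)) = x n" by simp
    then show ?thesis
      using x det_eq_1 unfolding matrix_mul_assoc adjugate_mult by simp
  qed
  have "x n = x N" if "n \<ge> N" for n
    by (rule dec_induct[OF that]) (auto simp: step)
  then have "\<forall>\<^sub>F n in sequentially. x n = x N"
    unfolding eventually_sequentially by blast
  then have "x \<longlonglongrightarrow> x N" by (rule tendsto_eventually)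
  with lim have "l = x N" by (rule LIMSEQ_unique)
  then show "l \<in> \<Union>\<Gamma>" using x by blast
qed

lemma finite_bounded:
  assumes "bounded S"
  shows "finite (\<Union>\<Gamma> \<inter> S)"
proof -
  have "compact (\<Union>\<Gamma> \<inter> closure S)"
    using assms closed_group by (simp add: closed_Int_compact)
  moreover have "discrete (\<Union>\<Gamma> \<inter> closure S)"
    using discrete by (rule discrete_subset) auto
  ultimately have "finite (\<Union>\<Gamma> \<inter> closure S)"
    using discrete_compact_finite_iff by blast
  then show ?thesis by (rule rev_finite_subset) (use closure_subset in auto)
qed

lemma countable_group: "countable (\<Union>\<Gamma>)"
proof -
  have "\<Union>\<Gamma> = (\<Union>n::nat. \<Union>\<Gamma> \<inter> cball 0 (real n))"
  proof (intro subset_antisym subsetI)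
    fix A :: "real^2^2" assume "A \<in> \<Union>\<Gamma>"
    obtain n :: nat where "norm A \<le> real n" using real_arch_simple by blast
    then have "A \<in> cball 0 (real n)" by simp
    with \<open>A \<in> \<Union>\<Gamma>\<close> show "A \<in> (\<Union>n::nat. \<Union>\<Gamma> \<inter> cball 0 (real n))" by blast
  qed blast
  moreover have "countable (\<Union>n::nat. \<Union>\<Gamma> \<inter> cball 0 (real n))"
    by (rule countable_UN) (auto intro!: countable_finite finite_bounded)
  ultimately show ?thesis by simp
qed

text \<open>Proper discontinuity. A lower bound for the imaginary part on \<open>K\<close> bounds
  the automorphy factor, an upper bound for the modulus then bounds the numerator, and together they
  bound all entries of \<open>A\<close>.\<close>

lemma finite_return:
  assumes "compact K" "K \<subseteq> upper_half_plane" "Im z > 0"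
  shows "finite {A \<in> \<Union>\<Gamma>. mobius_act A z \<in> K}"
proof (cases "K = {}")
  case False
  obtain k where k: "k \<in> K" "\<And>w. w \<in> K \<Longrightarrow> Im k \<le> Im w"
    using continuous_attains_inf[OF assms(1) False continuous_on_Im[OF continuous_on_id]] by auto
  have "Im k > 0" using k(1) assms(2) by (auto simp: upper_half_plane_def)
  obtain R where R: "R > 0" "\<And>w. w \<in> K \<Longrightarrow> cmod w \<le> R"
    using compact_imp_bounded[OF assms(1)] by (auto simp: bounded_pos)
  \<comment> \<open>From \<open>Im k \<le> Im z / |c z + d|\<^sup>2\<close> one gets
    \<open>M\<close> as a bound for \<open>|c z + d|\<close>, and \<open>R * M\<close> as a bound
    for \<open>|a z + b|\<close>. The number \<open>C\<close> collects the resulting bounds for the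
    four entries; each row then has norm at most \<open>2 * C\<close>.\<close>
  define M where "M = sqrt (Im z / Im k)"
  define C where "C = max (M + M / Im z * cmod z) (max (M / Im z)
     (max (R * M + R * M / Im z * cmod z) (R * M / Im z)))"
  have "norm A \<le> 4 * C" if A: "A \<in> \<Union>\<Gamma>" "mobius_act A z \<in> K" for A
  proof -
    have nz: "mobius_denom A z \<noteq> 0"
      using mobius_denom_nonzero det_eq_1[OF A(1)] assms(3) by simp
    have "Im k \<le> Im z / (cmod (mobius_denom A z))\<^sup>2"
      using k(2)[OF A(2)] Im_mobius_act[of A z] det_eq_1[OF A(1)] assms(3) by simp
    then have "(cmod (mobius_denom A z))\<^sup>2 \<le> Im z / Im k"
      using nz \<open>Im k > 0\<close> by (simp add: field_simps)
    then have d: "cmod (mobius_denom A z) \<le> M"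
      unfolding M_def by (rule real_le_rsqrt)
    have "of_real (A$1$1) * z + of_real (A$1$2) = mobius_act A z * mobius_denom A z"
      using nz by (simp add: mobius_act_eq)
    then have n: "cmod (of_real (A$1$1) * z + of_real (A$1$2)) \<le> R * M"
      using R(2)[OF A(2)] d R(1) by (simp add: norm_mult mult_mono)
    note coefficients_bounded[OF assms(3) n]
      coefficients_bounded[OF assms(3) d[unfolded mobius_denom_def]]
    then have "\<bar>A$1$1\<bar> \<le> C" "\<bar>A$1$2\<bar> \<le> C" "\<bar>A$2$1\<bar> \<le> C" "\<bar>A$2$2\<bar> \<le> C"
      by (simp_all only: C_def le_max_iff_disj) simp_all
    then have ij: "\<bar>A$i$j\<bar> \<le> C" for i j
      using exhaust_2[of i] exhaust_2[of j] by auto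
    have 1: "norm (A$i) \<le> C + C" for i
      using norm_le_l1_cart[of "A$i"] ij[of i 1] ij[of i 2] by (simp add: sum_2)
    have "norm A \<le> (\<Sum>i\<in>UNIV. norm (A$i))"
      unfolding norm_vec_def by (rule L2_set_le_sum) simp
    also have "\<dots> \<le> 4 * C" using 1[of 1] 1[of 2] by (simp add: sum_2)
    finally show ?thesis .
  qed
  then have "{A \<in> \<Union>\<Gamma>. mobius_act A z \<in> K} \<subseteq> \<Union>\<Gamma> \<inter> cball 0 (4 * C)"
    by (intro subsetI IntI) (simp_all del: Union_iff)
  then show ?thesis using finite_bounded[OF bounded_cball] by (rule finite_subset)
qed simp

lemma mem_orbit_of: "z \<in> orbit_of \<Gamma> z"
  unfolding orbit_of_def using one_mem by (rule rev_image_eqI) simp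

lemma orbit_of_mobius_act:
  assumes "A \<in> \<Union>\<Gamma>" "Im z > 0"
  shows "orbit_of \<Gamma> (mobius_act A z) = orbit_of \<Gamma> z"
proof -
  have sub: "orbit_of \<Gamma> (mobius_act B w) \<subseteq> orbit_of \<Gamma> w" if "B \<in> \<Union>\<Gamma>" "Im w > 0" for B w
    unfolding orbit_of_def
  proof (rule image_subsetI)
    fix C assume "C \<in> \<Union>\<Gamma>"
    then show "mobius_act C (mobius_act B w) \<in> (\<lambda>A. mobius_act A w) ` \<Union>\<Gamma>"
      using that mult_mem[of C B] det_eq_1 by (intro rev_image_eqI[of "C ** B"]) (auto simp: mobius_act_mult simp del: Union_iff)
  qed
  obtain B where B: "B \<in> \<Union>\<Gamma>" "B ** A = mat 1" using inverse_ex assms by blast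
  have "mobius_act B (mobius_act A z) = z"
    using B assms det_eq_1 by (metis mobius_act_mult mobius_act_one zero_less_one)
  then show ?thesis
    using sub[OF assms] sub[OF B(1), of "mobius_act A z"] Im_mobius_act_pos[of A z] assms det_eq_1
    by auto
qed

text \<open>A single orbit meets a compact set in finitely many points, so finitely many orbits
  cannot cover \<open>S\<close>.\<close>

lemma infinite_orbits:
  assumes "infinite S" "S \<subseteq> K" "compact K" "K \<subseteq> upper_half_plane"
  shows "infinite (orbit_of \<Gamma> ` S)"
proof
  assume "finite (orbit_of \<Gamma> ` S)"
  from pigeonhole_infinite[OF assms(1) this] obtain x0
    where x0: "x0 \<in> S" "infinite {x \<in> S. orbit_of \<Gamma> x = orbit_of \<Gamma> x0}" by auto
  have "{x \<in> S. orbit_of \<Gamma> x = orbit_of \<Gamma> x0} \<subseteq>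
      (\<lambda>A. mobius_act A x0) ` {A \<in> \<Union>\<Gamma>. mobius_act A x0 \<in> K}"
  proof
    fix x assume x: "x \<in> {x \<in> S. orbit_of \<Gamma> x = orbit_of \<Gamma> x0}"
    then have "x \<in> orbit_of \<Gamma> x0" using mem_orbit_of[of x] by auto
    then obtain A where "A \<in> \<Union>\<Gamma>" "x = mobius_act A x0" by (auto simp: orbit_of_def)
    then show "x \<in> (\<lambda>A. mobius_act A x0) ` {A \<in> \<Union>\<Gamma>. mobius_act A x0 \<in> K}"
      using x assms(2) by blast
  qed
  moreover have "finite {A \<in> \<Union>\<Gamma>. mobius_act A x0 \<in> K}"
    using x0(1) assms(2,4) by (intro finite_return assms(3,4)) (auto simp: upper_half_plane_def)
  ultimately show False using x0(2) finite_surj by blast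
qed

text \<open>This stands in for uniqueness of lifts in covering theory. The group element relating
  the two lines may at first depend on the time.\<close>

lemma geodesic_line_lift_unique:
  assumes "geodesic_line \<gamma>" "geodesic_line \<delta>" "\<And>t. orbit_of \<Gamma> (\<gamma> t) = orbit_of \<Gamma> (\<delta> t)"
  obtains A where "A \<in> \<Union>\<Gamma>" "\<And>t. \<delta> t = mobius_act A (\<gamma> t)"
proof -
  have "\<exists>A\<in>\<Union>\<Gamma>. \<delta> t = mobius_act A (\<gamma> t)" for t
    using mem_orbit_of[of "\<delta> t"] unfolding assms(3)[of t, symmetric] by (auto simp: orbit_of_def)
  then obtain f where f: "\<And>t. f t \<in> \<Union>\<Gamma>" "\<And>t. \<delta> t = mobius_act (f t) (\<gamma> t)" by metis
  \<comment> \<open>There are uncountably many times but only countably many group elements. An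
    element that serves two different times serves all, by rigidity.\<close>
  have "\<not> inj f"
  proof
    assume "inj f"
    have "countable (range f)" using f(1) countable_group by (intro countable_subset[OF _ countable_group]) auto
    then have "countable (UNIV :: real set)" using \<open>inj f\<close> by (simp add: countable_image_inj_eq)
    then show False using uncountable_UNIV_real by blast
  qed
  then obtain s r where sr: "s \<noteq> r" "f s = f r" by (auto simp: inj_on_def)
  have "\<delta> = (\<lambda>t. mobius_act (f s) (\<gamma> t))"
  proof (rule geodesic_line_eqI[OF assms(2) _ sr(1)])
    show "geodesic_line (\<lambda>t. mobius_act (f s) (\<gamma> t))"
      using det_eq_1[OF f(1)] assms(1) by (intro geodesic_line_mobius_act) auto
  qed (use f sr in auto)
  then show thesis using that f(1) by metis
qed

lemma closed_geodesic_translation: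
  assumes "geodesic_line \<gamma>" "\<And>t. orbit_of \<Gamma> (\<gamma> (t + L)) = orbit_of \<Gamma> (\<gamma> t)"
  obtains A where "A \<in> \<Union>\<Gamma>" "\<And>t. \<gamma> (t + L) = mobius_act A (\<gamma> t)"
  by (rule geodesic_line_lift_unique[OF assms(1) geodesic_line_shift[OF assms(1)], of L])
     (use assms(2) in auto)

text \<open>A least period exists because the periods up to \<open>L\<close> are finite in number:
  they correspond to group elements that return the base point to a compact segment of the
  line.\<close>

lemma primitive_closed_geodesic_ex:
  assumes \<gamma>: "geodesic_line \<gamma>" and "L > 0" "\<And>t. orbit_of \<Gamma> (\<gamma> (t + L)) = orbit_of \<Gamma> (\<gamma> t)"
  shows "\<exists>L. primitive_closed_geodesic \<Gamma> (\<lambda>t. orbit_of \<Gamma> (\<gamma> t)) L"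
proof -
  define P where "P = {p. 0 < p \<and> p \<le> L \<and> (\<forall>t. orbit_of \<Gamma> (\<gamma> (t + p)) = orbit_of \<Gamma> (\<gamma> t))}"
  have "\<gamma> ` P \<subseteq> (\<lambda>A. mobius_act A (\<gamma> 0)) ` {A \<in> \<Union>\<Gamma>. mobius_act A (\<gamma> 0) \<in> \<gamma> ` {0..L}}"
  proof (rule image_subsetI)
    fix p assume p: "p \<in> P"
    then obtain A where A: "A \<in> \<Union>\<Gamma>" "\<And>t. \<gamma> (t + p) = mobius_act A (\<gamma> t)"
      using closed_geodesic_translation[OF \<gamma>, of p] by (auto simp: P_def)
    then have "\<gamma> p = mobius_act A (\<gamma> 0)" by (metis add_0)
    moreover have "\<gamma> p \<in> \<gamma> ` {0..L}" using p by (auto simp: P_def)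
    ultimately show "\<gamma> p \<in> (\<lambda>A. mobius_act A (\<gamma> 0)) ` {A \<in> \<Union>\<Gamma>. mobius_act A (\<gamma> 0) \<in> \<gamma> ` {0..L}}"
      using A(1) by (intro rev_image_eqI[of A]) auto
  qed
  moreover have "finite {A \<in> \<Union>\<Gamma>. mobius_act A (\<gamma> 0) \<in> \<gamma> ` {0..L}}"
  proof (rule finite_return)
    show "compact (\<gamma> ` {0..L})"
      by (intro compact_continuous_image continuous_on_geodesic_line \<gamma>) simp
  qed (use \<gamma> Im_geodesic_line in \<open>auto simp: upper_half_plane_def\<close>)
  ultimately have "finite (\<gamma> ` P)" using finite_surj by blast
  \<comment> \<open>Injectivity of a geodesic line upstairs lets periods be counted by the points
    that they reach.\<close>
  then have "finite P" using inj_geodesic_line[OF \<gamma>] by (metis finite_image_iff inj_on_subset subset_UNIV)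
  moreover have "L \<in> P" using assms by (simp add: P_def)
  ultimately have Min: "Min P \<in> P" "\<And>p. p \<in> P \<Longrightarrow> Min P \<le> p" by (auto intro: Min_in)
  have "\<not> closed_geodesic \<Gamma> (\<lambda>t. orbit_of \<Gamma> (\<gamma> t)) (Min P / real n)" if "n \<ge> 2" for n
  proof
    assume "closed_geodesic \<Gamma> (\<lambda>t. orbit_of \<Gamma> (\<gamma> t)) (Min P / real n)"
    moreover have lt: "Min P / real n < Min P" using Min(1) that by (simp add: P_def field_simps)
    ultimately have "Min P / real n \<in> P" using Min(1) by (auto simp: P_def closed_geodesic_def)
    with Min(2) lt show False by fastforce
  qed
  then have "primitive_closed_geodesic \<Gamma> (\<lambda>t. orbit_of \<Gamma> (\<gamma> t)) (Min P)"
    using Min(1) \<gamma> by (auto simp: primitive_closed_geodesic_def closed_geodesic_def P_def)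
  then show ?thesis ..
qed

end

section \<open>Algebraic integers\<close>

definition int_poly :: "real poly \<Rightarrow> bool" where
  "int_poly p \<longleftrightarrow> (\<forall>i. Polynomial.coeff p i \<in> \<int>)"

lemma int_poly_diff: "int_poly p \<Longrightarrow> int_poly q \<Longrightarrow> int_poly (p - q)"
  by (simp add: int_poly_def)

lemma int_poly_mult: "int_poly p \<Longrightarrow> int_poly q \<Longrightarrow> int_poly (p * q)"
  by (auto simp: int_poly_def coeff_mult)

text \<open>Stated for a common degree bound \<open>e\<close>, so that it also yields 0 when a
  factor has smaller degree. This keeps off-diagonal entries below the diagonal degree during
  elimination.\<close>

lemma coeff_mult_top:
  fixes p q :: "real poly"
  assumes "Polynomial.degree p \<le> e" "Polynomial.degree q \<le> e"
  shows "Polynomial.coeff (p * q) (e + e) = Polynomial.coeff p e * Polynomial.coeff q e"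
proof -
  have "(\<Sum>i\<le>e + e. Polynomial.coeff p i * Polynomial.coeff q (e + e - i)) =
      (\<Sum>i\<in>{e}. Polynomial.coeff p i * Polynomial.coeff q (e + e - i))"
  proof (rule sum.mono_neutral_right)
    show "\<forall>i\<in>{..e + e} - {e}. Polynomial.coeff p i * Polynomial.coeff q (e + e - i) = 0"
    proof
      fix i assume "i \<in> {..e + e} - {e}"
      then have "i > e \<or> e + e - i > e" by auto
      then show "Polynomial.coeff p i * Polynomial.coeff q (e + e - i) = 0"
        using assms by (auto intro: coeff_eq_0)
    qed
  qed auto
  then show ?thesis by (simp add: coeff_mult)
qed

text \<open>Fraction-free Gaussian elimination: it preserves the shape ``monic of degree \<open>e\<close> on the
  diagonal, of smaller degree off it'', while doubling \<open>e\<close>.\<close>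

lemma algebraic_int_eliminate:
  fixes w :: "'i \<Rightarrow> real"
  assumes "finite J" "i0 \<notin> J" "w i0 \<noteq> 0"
    and "\<And>i j. int_poly (P i j)" "\<And>i j. Polynomial.degree (P i j) \<le> e"
    and "\<And>i j. Polynomial.coeff (P i j) e = (if i = j then 1 else 0)"
    and "\<And>i. i \<in> insert i0 J \<Longrightarrow> (\<Sum>j\<in>insert i0 J. poly (P i j) z * w j) = 0"
  shows "algebraic_int z"
  using assms
proof (induction J arbitrary: P e rule: finite_induct)
  case empty
  have "Polynomial.lead_coeff (P i0 i0) = 1"
    using empty.prems(4,5)[of i0 i0] by (metis le_antisym le_degree zero_neq_one)
  moreover have "poly (P i0 i0) z = 0" using empty.prems(2,6) by simp
  ultimately show ?case
    using empty.prems(3) by (intro algebraic_int.intros[of "P i0 i0"]) (auto simp: int_poly_def)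
next
  case (insert n J)
  define Q where "Q i j = P n n * P i j - P i n * P n j" for i j
  define e' where "e' = e + e"
  \<comment> \<open>The shape conditions range over all indices, while elimination makes row and
    column \<open>n\<close> of \<open>Q\<close> zero. Putting a pure power on the diagonal there
    restores the shape and does not affect the remaining rows.\<close>
  let ?Q = "\<lambda>i j. if i = n then (if j = n then Polynomial.monom 1 e' else 0)
    else if j = n then 0 else Q i j"
  show ?case
  proof (rule insert.IH[of ?Q e'])
    have ip: "int_poly (Q i j)" for i j
      unfolding Q_def by (intro int_poly_diff int_poly_mult insert.prems)
    have dp: "Polynomial.degree (Q i j) \<le> e'" for i j
      unfolding Q_def e'_def
      by (intro degree_diff_le order_trans[OF degree_mult_le] add_mono insert.prems)
    have cp: "Polynomial.coeff (Q i j) e' = (if i = j then 1 else 0)" if "i \<noteq> n" for i j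
      using that unfolding Q_def e'_def by (simp add: coeff_mult_top insert.prems)
    show "int_poly (?Q i j)" for i j
      using ip by (simp add: int_poly_def)
    show "Polynomial.degree (?Q i j) \<le> e'" for i j
      using dp by (simp add: degree_monom_le)
    show "Polynomial.coeff (?Q i j) e' = (if i = j then 1 else 0)" for i j
      using cp by auto
    fix i assume i: "i \<in> insert i0 J"
    then have "i \<noteq> n" using insert.hyps insert.prems(1) by auto
    have n: "n \<notin> insert i0 J" using insert.hyps insert.prems(1) by auto
    have "(\<Sum>j\<in>insert i0 J. poly (?Q i j) z * w j) = (\<Sum>j\<in>insert i0 J. poly (Q i j) z * w j)"
      using n \<open>i \<noteq> n\<close> by (intro sum.cong) auto
    also have "\<dots> = (\<Sum>j\<in>insert n (insert i0 J). poly (Q i j) z * w j)"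
      using n insert.hyps by (subst sum.insert) (auto simp: Q_def)
    also have "\<dots> = poly (P n n) z * (\<Sum>j\<in>insert n (insert i0 J). poly (P i j) z * w j)
        - poly (P i n) z * (\<Sum>j\<in>insert n (insert i0 J). poly (P n j) z * w j)"
      unfolding sum_distrib_left sum_subtractf[symmetric]
      by (intro sum.cong refl) (simp add: Q_def algebra_simps)
    also have "\<dots> = 0"
      using insert.prems(6)[of i] insert.prems(6)[of n] i unfolding insert_commute[of n] by auto
    finally show "(\<Sum>j\<in>insert i0 J. poly (?Q i j) z * w j) = 0" .
  qed (use insert.prems in auto)
qed

definition int_span :: "'i set \<Rightarrow> ('i \<Rightarrow> real) \<Rightarrow> real set" where
  "int_span I w = {\<Sum>j\<in>I. of_int (a j) * w j | a. True}"

lemma int_spanI: "(\<Sum>j\<in>I. of_int (a j) * w j) \<in> int_span I w"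
  by (auto simp: int_span_def)

lemma int_span_base: "finite I \<Longrightarrow> i \<in> I \<Longrightarrow> w i \<in> int_span I w"
proof -
  assume I: "finite I" "i \<in> I"
  have "(\<Sum>j\<in>I. of_int (if j = i then 1 else 0) * w j) = (\<Sum>j\<in>I. if j = i then w j else 0)"
    by (intro sum.cong) auto
  also have "\<dots> = w i" using I by simp
  finally show ?thesis by (metis int_spanI)
qed

lemma int_span_add: "x \<in> int_span I w \<Longrightarrow> y \<in> int_span I w \<Longrightarrow> x + y \<in> int_span I w"
proof -
  assume "x \<in> int_span I w" "y \<in> int_span I w"
  then obtain a b where "x = (\<Sum>j\<in>I. of_int (a j) * w j)" "y = (\<Sum>j\<in>I. of_int (b j) * w j)"
    by (auto simp: int_span_def)
  then have "x + y = (\<Sum>j\<in>I. of_int (a j + b j) * w j)"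
    by (simp add: sum.distrib distrib_right)
  then show ?thesis by (simp only: int_spanI)
qed

lemma int_span_mult: "x \<in> int_span I w \<Longrightarrow> of_int c * x \<in> int_span I w"
proof -
  assume "x \<in> int_span I w"
  then obtain a where "x = (\<Sum>j\<in>I. of_int (a j) * w j)" by (auto simp: int_span_def)
  then have "of_int c * x = (\<Sum>j\<in>I. of_int (c * a j) * w j)"
    by (simp add: sum_distrib_left mult.assoc)
  then show ?thesis by (simp only: int_spanI)
qed

lemma int_span_sum: "(\<And>i. i \<in> K \<Longrightarrow> f i \<in> int_span I w) \<Longrightarrow> (\<Sum>i\<in>K. of_int (c i) * f i) \<in> int_span I w"
proof (induction K rule: infinite_finite_induct)
  case (insert k K)
  then show ?case by (auto intro!: int_span_add int_span_mult)
qed (use int_spanI[where a = "\<lambda>_. 0"] in auto)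

text \<open>The determinant trick: \<open>w\<close> is a nonzero kernel vector of the characteristic
  matrix of multiplication by \<open>z\<close>, and elimination takes the place of its
  determinant.\<close>

lemma algebraic_int_of_stable_span:
  assumes "finite I" "i0 \<in> I" "w i0 \<noteq> 0" "\<And>i. i \<in> I \<Longrightarrow> z * w i \<in> int_span I w"
  shows "algebraic_int z"
proof -
  have "\<exists>a. \<forall>i\<in>I. z * w i = (\<Sum>j\<in>I. of_int (a i j) * w j)"
    using assms(4) unfolding int_span_def by (intro bchoice) auto
  then obtain a where a: "\<And>i. i \<in> I \<Longrightarrow> z * w i = (\<Sum>j\<in>I. of_int (a i j) * w j)" by blast
  define P where "P i j = (if i = j then [:- of_int (a i j), 1:] else [:- of_int (a i j):] :: real poly)" for i j
  have I: "insert i0 (I - {i0}) = I" using assms by auto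
  show ?thesis
  proof (rule algebraic_int_eliminate[of "I - {i0}" i0 w P 1])
    show "int_poly (P i j)" for i j
      by (auto simp: P_def int_poly_def coeff_pCons split: nat.split)
    show "(\<Sum>j\<in>insert i0 (I - {i0}). poly (P i j) z * w j) = 0" if "i \<in> insert i0 (I - {i0})" for i
    proof -
      have i: "i \<in> I" using that unfolding I .
      have "(\<Sum>j\<in>I. poly (P i j) z * w j) = (\<Sum>j\<in>I. (if i = j then z * w j else 0) - of_int (a i j) * w j)"
        by (intro sum.cong) (auto simp: P_def algebra_simps)
      also have "\<dots> = 0" using assms(1) i a[OF i] by (simp add: sum_subtractf)
      finally show ?thesis unfolding I .
    qed
  qed (use assms in \<open>auto simp: P_def\<close>)
qed

lemma algebraic_int_stable_powers:
  fixes x :: real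
  assumes "algebraic_int x"
  obtains m where "m > 0" "\<And>i. i < m \<Longrightarrow> x * x ^ i \<in> int_span {..<m} (\<lambda>k. x ^ k)"
proof -
  from assms obtain p where p: "Polynomial.lead_coeff p = 1" "\<forall>i. Polynomial.coeff p i \<in> \<int>" "poly p x = 0"
    by (auto simp: algebraic_int.simps)
  define m where "m = Polynomial.degree p"
  have "\<forall>i. \<exists>c. Polynomial.coeff p i = of_int c" using p(2) by (auto elim!: Ints_cases)
  then obtain c where c: "\<And>i. Polynomial.coeff p i = of_int (c i)" by metis
  have "m > 0" using p by (intro Nat.gr0I) (auto simp: m_def elim!: degree_eq_zeroE)
  moreover have "x * x ^ i \<in> int_span {..<m} (\<lambda>k. x ^ k)" if "i < m" for i
  \<comment> \<open>Multiplication by \<open>x\<close> shifts the powers along; only the last one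
    leaves the range and has to be rewritten by the monic equation.\<close>
  proof (cases "Suc i = m")
    case True
    have "0 = (\<Sum>k\<le>m. Polynomial.coeff p k * x ^ k)"
      using p(3) by (simp add: poly_altdef m_def)
    also have "\<dots> = Polynomial.coeff p m * x ^ m + (\<Sum>k<m. Polynomial.coeff p k * x ^ k)"
      unfolding lessThan_Suc_atMost[symmetric] by simp
    also have "\<dots> = x ^ m + (\<Sum>k<m. of_int (c k) * x ^ k)"
      using p(1) unfolding m_def[symmetric] by (simp only: c mult_1)
    finally have "x ^ m = (\<Sum>k<m. of_int (- c k) * x ^ k)" by (simp add: sum_negf)
    then show ?thesis using True by (metis int_spanI power_Suc)
  next
    case False
    then show ?thesis using that int_span_base[of "{..<m}" "Suc i" "\<lambda>k. x ^ k"] by simp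
  qed
  ultimately show thesis using that by blast
qed

text \<open>The integral span of the products \<open>x ^ i * y ^ j\<close> is stable under
  multiplication by \<open>x + y\<close>. The result makes orders closed under addition.\<close>

lemma algebraic_int_plus:
  fixes x y :: real
  assumes "algebraic_int x" "algebraic_int y"
  shows "algebraic_int (x + y)"
proof -
  obtain m where m: "m > 0" "\<And>i. i < m \<Longrightarrow> x * x ^ i \<in> int_span {..<m} (\<lambda>k. x ^ k)"
    using algebraic_int_stable_powers[OF assms(1)] by blast
  obtain n where n: "n > 0" "\<And>i. i < n \<Longrightarrow> y * y ^ i \<in> int_span {..<n} (\<lambda>k. y ^ k)"
    using algebraic_int_stable_powers[OF assms(2)] by blast
  let ?w = "\<lambda>(i, j). x ^ i * y ^ j"
  let ?I = "{..<m} \<times> {..<n}"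
  have "(x + y) * ?w (i, j) \<in> int_span ?I ?w" if ij: "i < m" "j < n" for i j
  proof -
    obtain a where a: "x * x ^ i = (\<Sum>k<m. of_int (a k) * x ^ k)" using m(2)[OF ij(1)] by (auto simp: int_span_def)
    obtain b where b: "y * y ^ j = (\<Sum>k<n. of_int (b k) * y ^ k)" using n(2)[OF ij(2)] by (auto simp: int_span_def)
    have "(x + y) * ?w (i, j) = (x * x ^ i) * y ^ j + x ^ i * (y * y ^ j)" by (simp add: algebra_simps)
    also have "\<dots> = (\<Sum>k<m. of_int (a k) * ?w (k, j)) + (\<Sum>k<n. of_int (b k) * ?w (i, k))"
      unfolding a b by (simp add: sum_distrib_left sum_distrib_right mult_ac)
    also have "\<dots> \<in> int_span ?I ?w"
      using ij by (intro int_span_add int_span_sum int_span_base) auto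
    finally show ?thesis .
  qed
  then show ?thesis
    using m(1) n(1) by (intro algebraic_int_of_stable_span[of ?I "(0, 0)" ?w]) auto
qed

lemma algebraic_int_lead_coeff_mult:
  fixes x :: real
  assumes "int_poly p" "p \<noteq> 0" "poly p x = 0"
  shows "algebraic_int (Polynomial.lead_coeff p * x)"
proof -
  define d where "d = Polynomial.degree p"
  define c where "c = Polynomial.lead_coeff p"
  have "c \<noteq> 0" using assms by (simp add: c_def)
  have "d > 0" using assms by (intro Nat.gr0I) (auto simp: d_def elim!: degree_eq_zeroE)
  \<comment> \<open>This is \<open>c ^ (d - 1) * p (X / c)\<close>, which is monic and still has
    integer coefficients.\<close>
  define q where "q = Polynomial.monom 1 d + (\<Sum>i<d. Polynomial.monom (Polynomial.coeff p i * c ^ (d - 1 - i)) i)"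
  have cq: "Polynomial.coeff q k = (if k = d then 1 else if k < d then Polynomial.coeff p k * c ^ (d - 1 - k) else 0)" for k
    by (auto simp: q_def coeff_sum)
  have "Polynomial.degree q = d"
    by (rule antisym) (auto intro!: degree_le le_degree simp: cq)
  have "poly q (c * x) = (c * x) ^ d + (\<Sum>i<d. Polynomial.coeff p i * c ^ (d - 1 - i) * (c * x) ^ i)"
    by (simp add: q_def poly_sum poly_monom)
  also have "(\<Sum>i<d. Polynomial.coeff p i * c ^ (d - 1 - i) * (c * x) ^ i) =
      (\<Sum>i<d. c ^ (d - 1) * (Polynomial.coeff p i * x ^ i))"
  proof (intro sum.cong refl)
    fix i assume "i \<in> {..<d}"
    then have "c ^ (d - 1) = c ^ (d - 1 - i) * c ^ i" by (simp flip: power_add)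
    then show "Polynomial.coeff p i * c ^ (d - 1 - i) * (c * x) ^ i = c ^ (d - 1) * (Polynomial.coeff p i * x ^ i)"
      by (simp add: power_mult_distrib)
  qed
  also have "(c * x) ^ d = c ^ (d - 1) * (Polynomial.coeff p d * x ^ d)"
  proof -
    have "Polynomial.coeff p d = c" by (simp add: c_def d_def)
    moreover have "c ^ d = c ^ (d - 1) * c" using \<open>d > 0\<close> by (rule power_minus_mult[symmetric])
    ultimately show ?thesis by (simp add: power_mult_distrib)
  qed
  also have "c ^ (d - 1) * (Polynomial.coeff p d * x ^ d) + (\<Sum>i<d. c ^ (d - 1) * (Polynomial.coeff p i * x ^ i)) =
      c ^ (d - 1) * (\<Sum>i\<le>d. Polynomial.coeff p i * x ^ i)"
    unfolding lessThan_Suc_atMost[symmetric] sum.lessThan_Suc sum_distrib_left[symmetric]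
    by (simp only: distrib_left add.commute)
  also have "\<dots> = 0" using assms(3) by (simp add: poly_altdef d_def)
  finally have "poly q (c * x) = 0" .
  moreover have "Polynomial.coeff q k \<in> \<int>" for k
    using assms(1) by (auto simp: cq int_poly_def c_def)
  ultimately show ?thesis
    using \<open>Polynomial.degree q = d\<close> cq unfolding c_def[symmetric] by (intro algebraic_int.intros[of q]) auto
qed

text \<open>All multiples of \<open>n\<close> are included so that one product of denominators can
  later serve finitely many coordinates at once.\<close>

lemma algebraic_imp_int_multiple:
  fixes x :: real
  assumes "algebraic x"
  obtains n :: nat where "n > 0" "\<And>m. n dvd m \<Longrightarrow> algebraic_int (real m * x)"
proof -
  obtain p where p: "\<And>i. Polynomial.coeff p i \<in> \<int>" "p \<noteq> 0" "poly p x = 0"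
    using assms by (auto simp: algebraic_def)
  obtain c where c: "Polynomial.lead_coeff p = of_int c" using p(1) by (metis Ints_cases)
  have "c \<noteq> 0" using p(2) c by auto
  show thesis
  proof (rule that[of "nat \<bar>c\<bar>"])
    show "nat \<bar>c\<bar> > 0" using \<open>c \<noteq> 0\<close> by simp
    fix m assume dvd: "nat \<bar>c\<bar> dvd m"
    then obtain k where k: "m = nat \<bar>c\<bar> * k" by blast
    show "algebraic_int (real m * x)"
    proof (cases "k = 0")
      case False
      \<comment> \<open>Scaling the polynomial by \<open>k\<close> makes its leading coefficient
        \<open>k * c\<close>, which gives the multiple directly. The sign lost in
        \<open>nat \<bar>c\<bar>\<close> is repaired afterwards.\<close>
      have "algebraic_int (Polynomial.lead_coeff (Polynomial.smult (of_nat k) p) * x)"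
        using p False by (intro algebraic_int_lead_coeff_mult) (auto simp: int_poly_def)
      then have "algebraic_int (real k * of_int c * x)" using False by (simp add: c)
      moreover have "real m * x = real k * of_int c * x \<or> real m * x = - (real k * of_int c * x)"
        by (auto simp: k abs_if)
      ultimately show ?thesis by (metis algebraic_int_minus)
    qed (simp add: k)
  qed
qed

section \<open>Residues of the ring generated by an algebraic number\<close>

text \<open>The additive group underlying \<open>\<int>[t]\<close>, in Horner form.\<close>

inductive_set int_adjoin :: "real \<Rightarrow> real set" for t where
  zero: "0 \<in> int_adjoin t"
| horner: "x \<in> int_adjoin t \<Longrightarrow> of_int c + t * x \<in> int_adjoin t"

lemma int_adjoin_of_int: "of_int c \<in> int_adjoin t"
  using int_adjoin.horner[OF int_adjoin.zero, of c t] by simp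

lemma int_adjoin_times: "x \<in> int_adjoin t \<Longrightarrow> t * x \<in> int_adjoin t"
  using int_adjoin.horner[of x t 0] by simp

lemma int_adjoin_power: "t ^ i \<in> int_adjoin t"
  using int_adjoin_of_int[of 1 t] by (induction i) (auto intro: int_adjoin_times)

lemma int_adjoin_add:
  assumes "x \<in> int_adjoin t" "y \<in> int_adjoin t"
  shows "x + y \<in> int_adjoin t"
  using assms
proof (induction arbitrary: y)
  case (horner x c)
  from horner.prems show ?case
  proof cases
    case zero
    then show ?thesis using int_adjoin.horner[OF horner.hyps, of c] by simp
  next
    case (horner z d)
    have "of_int c + t * x + y = of_int (c + d) + t * (x + z)"
      unfolding horner by (simp add: algebra_simps)
    then show ?thesis using horner(2) horner.IH int_adjoin.horner by metis
  qed
qed simp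

lemma int_adjoin_int_mult: "x \<in> int_adjoin t \<Longrightarrow> of_int c * x \<in> int_adjoin t"
proof (induction rule: int_adjoin.induct)
  case (horner x d)
  have "of_int c * (of_int d + t * x) = of_int (c * d) + t * (of_int c * x)" by (simp add: algebra_simps)
  then show ?case using horner.IH int_adjoin.horner by metis
qed (simp add: int_adjoin.zero)

lemma int_adjoin_diff: "x \<in> int_adjoin t \<Longrightarrow> y \<in> int_adjoin t \<Longrightarrow> x - y \<in> int_adjoin t"
  using int_adjoin_add[of x t "- y"] int_adjoin_int_mult[of y t "-1"] by simp

lemma int_adjoin_sum:
  "(\<And>i. i \<in> K \<Longrightarrow> f i \<in> int_adjoin t) \<Longrightarrow> sum f K \<in> int_adjoin t"
  by (induction K rule: infinite_finite_induct) (auto intro: int_adjoin_add int_adjoin.zero)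

text \<open>A primitive integer polynomial vanishing at \<open>t\<close> does not vanish modulo
  \<open>p\<close>, and \<open>j\<close> is the degree of its reduction.\<close>

lemma algebraic_primitive_relation:
  fixes t :: real
  assumes "algebraic t" "Factorial_Ring.prime (p :: nat)"
  obtains c :: "nat \<Rightarrow> int" and j d where
    "(\<Sum>i\<le>d. of_int (c i) * t ^ i) = 0" "j \<le> d" "\<not> int p dvd c j" "\<And>i. j < i \<Longrightarrow> int p dvd c i"
proof -
  obtain P :: "int poly" where P: "P \<noteq> 0" "poly (map_poly of_int P) t = 0"
    using assms(1) by (elim algebraicE')
  define Q where "Q = primitive_part P"
  have PQ: "P = Polynomial.smult (content P) Q" by (simp add: Q_def)
  have "content Q = 1" using P(1) by (simp add: Q_def content_primitive_part)
  define J where "J = {i. \<not> int p dvd Polynomial.coeff Q i}"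
  have "J \<noteq> {}"
  proof
    assume "J = {}"
    then have "[:int p:] dvd Q" by (auto simp: J_def const_poly_dvd_iff)
    then have "int p dvd content Q" by (simp add: const_poly_dvd_iff_dvd_content)
    then show False using \<open>content Q = 1\<close> assms(2) by (auto simp: prime_nat_iff)
  qed
  have sub: "J \<subseteq> {..Polynomial.degree Q}"
  proof
    fix i assume "i \<in> J"
    then have "Polynomial.coeff Q i \<noteq> 0" by (auto simp: J_def)
    then show "i \<in> {..Polynomial.degree Q}" by (simp add: le_degree)
  qed
  then have fin: "finite J" by (rule finite_subset) simp
  show thesis
  proof (rule that[of "Polynomial.coeff Q" "Polynomial.degree Q" "Max J"])
    have "poly (map_poly of_int P) t = of_int (content P) * poly (map_poly of_int Q) t"
      by (subst (1) PQ) (simp add: map_poly_smult)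
    then have "poly (map_poly of_int Q) t = 0" using P by simp
    then show "(\<Sum>i\<le>Polynomial.degree Q. of_int (Polynomial.coeff Q i) * t ^ i) = 0"
      by (simp add: poly_altdef degree_map_poly coeff_map_poly)
    have "Max J \<in> J" using \<open>J \<noteq> {}\<close> fin by (rule Max_in[rotated])
    then show "Max J \<le> Polynomial.degree Q" "\<not> int p dvd Polynomial.coeff Q (Max J)"
      using sub by (auto simp: J_def)
    fix i assume "Max J < i"
    then have "i \<notin> J" using fin Max_ge leD by blast
    then show "int p dvd Polynomial.coeff Q i" by (simp add: J_def)
  qed
qed

text \<open>Modulo \<open>p\<close> the relation has an invertible leading coefficient at
  \<open>t ^ j\<close>, so the powers below \<open>j\<close> span all residues. Finiteness thus
  holds even for algebraic numbers that are not integral.\<close>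

lemma finite_residues_prime:
  assumes "algebraic t" "Factorial_Ring.prime (p :: nat)"
  shows "\<exists>S. finite S \<and> (\<forall>x\<in>int_adjoin t. \<exists>s\<in>S. \<exists>y\<in>int_adjoin t. x = s + real p * y)"
proof -
  from assms obtain c :: "nat \<Rightarrow> int" and j d where
    c: "(\<Sum>i\<le>d. of_int (c i) * t ^ i) = 0" "j \<le> d" "\<not> int p dvd c j" "\<And>i. j < i \<Longrightarrow> int p dvd c i"
    by (rule algebraic_primitive_relation) blast
  have "p > 0" using assms(2) by (simp add: prime_gt_0_nat)
  \<comment> \<open>The candidate for all of \<open>int_adjoin t\<close>. The crucial point is that
    it contains \<open>t ^ j\<close>; Horner steps then never leave it.\<close>
  define N where "N = {(\<Sum>i<j. of_int (a i) * t ^ i) + real p * y | a y. y \<in> int_adjoin t}"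
  have N_I: "(\<Sum>i<j. of_int (a i) * t ^ i) + real p * y \<in> N" if "y \<in> int_adjoin t" for a y
    using that by (auto simp: N_def)
  have N_add: "x + y \<in> N" if "x \<in> N" "y \<in> N" for x y
  proof -
    from that obtain a b u v where "x = (\<Sum>i<j. of_int (a i) * t ^ i) + real p * u"
      "y = (\<Sum>i<j. of_int (b i) * t ^ i) + real p * v" and uv: "u \<in> int_adjoin t" "v \<in> int_adjoin t"
      by (auto simp: N_def)
    then have "x + y = (\<Sum>i<j. of_int (a i + b i) * t ^ i) + real p * (u + v)"
      by (simp add: sum.distrib algebra_simps)
    then show ?thesis using int_adjoin_add[OF uv] by (simp only: N_I)
  qed
  have N_mult: "of_int k * x \<in> N" if "x \<in> N" for x k
  proof -
    from that obtain a u where "x = (\<Sum>i<j. of_int (a i) * t ^ i) + real p * u" and u: "u \<in> int_adjoin t"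
      by (auto simp: N_def)
    then have "of_int k * x = (\<Sum>i<j. of_int (k * a i) * t ^ i) + real p * (of_int k * u)"
      by (simp add: sum_distrib_left algebra_simps)
    then show ?thesis using int_adjoin_int_mult[OF u] by (simp only: N_I)
  qed
  have N_p: "real p * y \<in> N" if "y \<in> int_adjoin t" for y
    using N_I[OF that, of "\<lambda>_. 0"] by simp
  have N_sum: "sum f K \<in> N" if "\<And>i. i \<in> K \<Longrightarrow> f i \<in> N" for f and K :: "nat set"
    using that N_p[OF int_adjoin.zero]
    by (induction K rule: infinite_finite_induct) (auto intro: N_add)
  have N_lt: "t ^ k \<in> N" if "k < j" for k
  proof -
    have "(\<Sum>i<j. of_int (if i = k then 1 else 0) * t ^ i) = (\<Sum>i<j. if i = k then t ^ i else 0)"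
      by (intro sum.cong) auto
    also have "\<dots> = t ^ k" using that by simp
    finally have "t ^ k = (\<Sum>i<j. of_int (if i = k then 1 else 0) * t ^ i) + real p * 0" by simp
    then show ?thesis using int_adjoin.zero[of t] by (simp only: N_I)
  qed
  have "t ^ j \<in> N"
  proof -
    have "{..d} = {..<j} \<union> {j} \<union> {j<..d}" using c(2) by auto
    then have "(\<Sum>i\<le>d. of_int (c i) * t ^ i) = (\<Sum>i\<in>{..<j} \<union> {j} \<union> {j<..d}. of_int (c i) * t ^ i)" by simp
    also have "\<dots> = (\<Sum>i\<in>{..<j} \<union> {j}. of_int (c i) * t ^ i) + (\<Sum>i\<in>{j<..d}. of_int (c i) * t ^ i)"
      by (rule sum.union_disjoint) auto
    also have "(\<Sum>i\<in>{..<j} \<union> {j}. of_int (c i) * t ^ i) = of_int (c j) * t ^ j + (\<Sum>i<j. of_int (c i) * t ^ i)"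
      by simp
    finally have "of_int (c j) * t ^ j = of_int (-1) *
        ((\<Sum>i<j. of_int (c i) * t ^ i) + (\<Sum>i\<in>{j<..d}. of_int (c i) * t ^ i))"
      using c(1) by simp
    also have "\<dots> \<in> N"
    proof (rule N_mult[OF N_add])
      show "(\<Sum>i<j. of_int (c i) * t ^ i) \<in> N" by (intro N_sum N_mult N_lt) auto
      show "(\<Sum>i\<in>{j<..d}. of_int (c i) * t ^ i) \<in> N"
      proof (rule N_sum)
        fix i assume "i \<in> {j<..d}"
        then obtain k where "c i = int p * k" using c(4)[of i] by auto
        then have "of_int (c i) * t ^ i = real p * (of_int k * t ^ i)" by simp
        then show "of_int (c i) * t ^ i \<in> N"
          using N_p int_adjoin_int_mult[OF int_adjoin_power] by metis
      qed
    qed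
    finally have cj: "of_int (c j) * t ^ j \<in> N" .
    \<comment> \<open>Bezout inverts \<open>c j\<close> modulo \<open>p\<close>, which isolates
      \<open>t ^ j\<close> itself.\<close>
    have "coprime (int p) (c j)" using assms(2) c(3) by (simp add: prime_imp_coprime)
    then obtain u v where "u * int p + v * c j = 1" using coprime_iff_gcd_eq_1 bezout_int by metis
    then have "of_int u * real p + of_int v * of_int (c j) = (1 :: real)"
      by (metis of_int_1 of_int_add of_int_mult of_int_of_nat_eq)
    then have "t ^ j = of_int v * (of_int (c j) * t ^ j) + real p * (of_int u * t ^ j)"
      by (metis (no_types, opaque_lifting) add.commute distrib_right mult.assoc mult.commute mult_1)
    then show ?thesis using N_add[OF N_mult[OF cj] N_p[OF int_adjoin_int_mult[OF int_adjoin_power]]] by metis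
  qed
  then have N_le: "t ^ k \<in> N" if "k \<le> j" for k using N_lt that by (cases "k = j") auto
  have int_adjoin_N: "x \<in> N" if "x \<in> int_adjoin t" for x
    using that
  proof induction
    case zero
    show ?case using N_p[OF int_adjoin.zero] by simp
  next
    case (horner x k)
    from horner.IH obtain a y where x: "x = (\<Sum>i<j. of_int (a i) * t ^ i) + real p * y" and y: "y \<in> int_adjoin t"
      by (auto simp: N_def)
    have "of_int k + t * x = of_int k * t ^ 0 + (\<Sum>i<j. of_int (a i) * t ^ Suc i) + real p * (t * y)"
      unfolding x by (simp add: algebra_simps sum_distrib_left)
    also have "\<dots> \<in> N"
      by (intro N_add N_sum N_mult N_p N_le int_adjoin_times y) auto
    finally show ?case .
  qed
  \<comment> \<open>Coefficients matter only modulo \<open>p\<close>, so the digits from 0 to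
    \<open>p - 1\<close> suffice as representatives.\<close>
  define S where "S = (\<lambda>a. \<Sum>i<j. of_int (a i) * t ^ i) ` ({..<j} \<rightarrow>\<^sub>E {0..<int p})"
  have "\<exists>s\<in>S. \<exists>y\<in>int_adjoin t. x = s + real p * y" if x': "x \<in> int_adjoin t" for x
  proof -
    obtain a y where x: "x = (\<Sum>i<j. of_int (a i) * t ^ i) + real p * y" and y: "y \<in> int_adjoin t"
      using int_adjoin_N[OF x'] by (auto simp: N_def)
    define b where "b = restrict (\<lambda>i. a i mod int p) {..<j}"
    define z where "z = (\<Sum>i<j. of_int (a i div int p) * t ^ i)"
    have "(\<Sum>i<j. of_int (a i) * t ^ i) = (\<Sum>i<j. of_int (b i) * t ^ i) + real p * z"
      unfolding z_def sum_distrib_left sum.distrib[symmetric]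
    proof (intro sum.cong refl)
      fix i assume "i \<in> {..<j}"
      then have "a i = b i + int p * (a i div int p)" by (simp add: b_def)
      then have "(of_int (a i) :: real) = of_int (b i) + real p * of_int (a i div int p)"
        by (metis of_int_add of_int_mult of_int_of_nat_eq)
      then show "of_int (a i) * t ^ i = of_int (b i) * t ^ i + real p * (of_int (a i div int p) * t ^ i)"
        by (simp add: algebra_simps)
    qed
    then have "x = (\<Sum>i<j. of_int (b i) * t ^ i) + real p * (z + y)"
      unfolding x by (simp add: algebra_simps)
    moreover have "(\<Sum>i<j. of_int (b i) * t ^ i) \<in> S"
      unfolding S_def by (rule imageI) (use \<open>p > 0\<close> in \<open>auto simp: b_def\<close>)
    moreover have "z + y \<in> int_adjoin t"
      unfolding z_def by (intro int_adjoin_add int_adjoin_sum int_adjoin_int_mult int_adjoin_power y)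
    ultimately show ?thesis by blast
  qed
  moreover have "finite S" unfolding S_def by (intro finite_imageI finite_PiE) auto
  ultimately show ?thesis by blast
qed

text \<open>Split off one prime factor at a time: a residue modulo \<open>p * m\<close> is a residue
  modulo \<open>p\<close> plus \<open>p\<close> times a residue modulo \<open>m\<close>.\<close>

lemma finite_residues:
  assumes "algebraic t" "n > 0"
  shows "\<exists>S. finite S \<and> (\<forall>x\<in>int_adjoin t. \<exists>s\<in>S. \<exists>y\<in>int_adjoin t. x = s + real n * y)"
  using assms(2)
proof (induction n rule: less_induct)
  case (less n)
  show ?case
  proof (cases "n = 1")
    case True
    then show ?thesis by (intro exI[of _ "{0}"]) auto
  next
    case False
    then obtain p where p: "Factorial_Ring.prime p" "p dvd n" using prime_factor_nat by blast
    then obtain m where n: "n = p * m" by blast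
    have "m > 0" "m < n" using less.prems n prime_gt_1_nat[OF p(1)] by auto
    from less.IH[OF this(2,1)] obtain S' where
      S': "finite S'" "\<And>x. x \<in> int_adjoin t \<Longrightarrow> \<exists>s\<in>S'. \<exists>y\<in>int_adjoin t. x = s + real m * y" by blast
    obtain S where S: "finite S" "\<And>x. x \<in> int_adjoin t \<Longrightarrow> \<exists>s\<in>S. \<exists>y\<in>int_adjoin t. x = s + real p * y"
      using finite_residues_prime[OF assms(1) p(1)] by blast
    let ?T = "(\<lambda>(s, s'). s + real p * s') ` (S \<times> S')"
    have "\<exists>s\<in>?T. \<exists>y\<in>int_adjoin t. x = s + real n * y" if x: "x \<in> int_adjoin t" for x
    proof -
      obtain s y where s: "s \<in> S" "y \<in> int_adjoin t" "x = s + real p * y" using S(2)[OF x] by blast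
      obtain s' z where s': "s' \<in> S'" "z \<in> int_adjoin t" "y = s' + real m * z" using S'(2)[OF s(2)] by blast
      have "x = (s + real p * s') + real n * z" by (simp add: s(3) s'(3) n algebra_simps)
      moreover have "s + real p * s' \<in> ?T" using s(1) s'(1) by force
      ultimately show ?thesis using s'(2) by blast
    qed
    moreover have "finite ?T" using S(1) S'(1) by simp
    ultimately show ?thesis by blast
  qed
qed

text \<open>The Chebyshev polynomials of the second kind in \<open>t / 2\<close>, with index shifted
  by one: these are the coefficients that express powers of an element of trace \<open>t\<close> and
  norm 1.\<close>

fun chebyshev_U :: "real \<Rightarrow> nat \<Rightarrow> real" where
  "chebyshev_U t 0 = 0"
| "chebyshev_U t (Suc 0) = 1"
| "chebyshev_U t (Suc (Suc k)) = t * chebyshev_U t (Suc k) - chebyshev_U t k"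

lemma chebyshev_U_int_adjoin: "chebyshev_U t k \<in> int_adjoin t"
  by (induction t k rule: chebyshev_U.induct)
     (use int_adjoin_of_int[of 1] in \<open>auto intro: int_adjoin.zero int_adjoin_diff int_adjoin_times\<close>)

text \<open>Two consecutive values determine the recursion, and there are finitely many pairs of
  residues, so some pair recurs. As the recursion can be run backwards, the pair at index 0 recurs
  too.\<close>

lemma chebyshev_U_periodic_mod:
  assumes "algebraic t" "n > 0"
  obtains k a b where "k > 0" "a \<in> int_adjoin t" "b \<in> int_adjoin t"
    "chebyshev_U t k = real n * b" "chebyshev_U t (Suc k) = 1 + real n * a"
proof -
  let ?U = "chebyshev_U t"
  obtain S where S: "finite S" "\<And>x. x \<in> int_adjoin t \<Longrightarrow> \<exists>s\<in>S. \<exists>y\<in>int_adjoin t. x = s + real n * y"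
    using finite_residues[OF assms] by blast
  have "\<forall>k. \<exists>s\<in>S. \<exists>y\<in>int_adjoin t. ?U k = s + real n * y"
    using S(2) chebyshev_U_int_adjoin by blast
  then obtain s where s: "\<And>k. s k \<in> S" "\<And>k. \<exists>y\<in>int_adjoin t. ?U k = s k + real n * y" by metis
  define cong where "cong x y \<longleftrightarrow> (\<exists>z\<in>int_adjoin t. x - y = real n * z)" for x y
  have cong: "cong (?U i) (?U j)" if "s i = s j" for i j
  proof -
    obtain y where y: "y \<in> int_adjoin t" "?U i = s i + real n * y" using s(2) by blast
    obtain z where z: "z \<in> int_adjoin t" "?U j = s j + real n * z" using s(2) by blast
    have "?U i - ?U j = real n * (y - z)" using y z that by (simp add: algebra_simps)
    then show ?thesis unfolding cong_def using int_adjoin_diff[OF y(1) z(1)] by blast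
  qed
  have "\<not> inj (\<lambda>k. (s k, s (Suc k)))"
  proof
    assume "inj (\<lambda>k. (s k, s (Suc k)))"
    moreover have "finite (range (\<lambda>k. (s k, s (Suc k))))"
      by (rule finite_subset[of _ "S \<times> S"]) (use S(1) s(1) in auto)
    ultimately show False by (simp add: finite_image_iff)
  qed
  then obtain i j where "i < j" "s i = s j" "s (Suc i) = s (Suc j)"
    by (auto simp: inj_on_def) (metis linorder_neqE_nat)
  then obtain k where k: "k > 0" "cong (?U (i + k)) (?U i)" "cong (?U (Suc (i + k))) (?U (Suc i))"
    using cong by (metis less_imp_add_positive)
  \<comment> \<open>The step down uses that \<open>U\<^sub>i\<close> equals \<open>t\<close> times
    \<open>U\<^sub>i\<^sub>+\<^sub>1\<close> minus \<open>U\<^sub>i\<^sub>+\<^sub>2\<close>, with no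
    division.\<close>
  have "cong (?U (i + k)) (?U i) \<Longrightarrow> cong (?U (Suc (i + k))) (?U (Suc i)) \<Longrightarrow>
      cong (?U k) (?U 0) \<and> cong (?U (Suc k)) (?U (Suc 0))"
  proof (induction i)
    case (Suc i)
    obtain y where y: "y \<in> int_adjoin t" "?U (Suc i + k) - ?U (Suc i) = real n * y"
      using Suc.prems(1) by (auto simp: cong_def)
    obtain z where z: "z \<in> int_adjoin t" "?U (Suc (Suc i + k)) - ?U (Suc (Suc i)) = real n * z"
      using Suc.prems(2) by (auto simp: cong_def)
    have "?U (i + k) - ?U i = t * (?U (Suc i + k) - ?U (Suc i)) - (?U (Suc (Suc i + k)) - ?U (Suc (Suc i)))"
      by (simp add: algebra_simps)
    also have "\<dots> = real n * (t * y - z)"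
      unfolding y z by (simp add: algebra_simps)
    finally have "cong (?U (i + k)) (?U i)"
      unfolding cong_def using int_adjoin_diff[OF int_adjoin_times[OF y(1)] z(1)] by blast
    then show ?case using Suc.IH Suc.prems(1) by simp
  qed simp
  with k have "cong (?U k) (?U 0)" "cong (?U (Suc k)) (?U (Suc 0))" by auto
  then obtain a b where "a \<in> int_adjoin t" "b \<in> int_adjoin t" "?U k = real n * b" "?U (Suc k) - 1 = real n * a"
    by (auto simp: cong_def)
  then show thesis using that[OF k(1), of a b] by (simp add: algebra_simps)
qed

section \<open>Elements of a number field are algebraic\<close>

lemma real_field_simps:
  "x \<otimes>\<^bsub>real_field\<^esub> y = x * y" "x \<oplus>\<^bsub>real_field\<^esub> y = x + y"
  "\<one>\<^bsub>real_field\<^esub> = 1" "\<zero>\<^bsub>real_field\<^esub> = 0" "carrier real_field = UNIV"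
  by (simp_all add: ring_of_type_algebra_def)

lemma real_field_power: "x [^]\<^bsub>real_field\<^esub> n = x ^ n" for n :: nat
  by (induction n) (simp_all add: real_field_simps nat_pow_def mult.commute)

lemma real_field_a_inv: "\<ominus>\<^bsub>real_field\<^esub> x = - x"
  by (rule abelian_group.minus_equality)
     (simp_all add: real_field_simps ring.is_abelian_group ring_from_type_algebra)

lemma real_field_m_inv: "x \<noteq> 0 \<Longrightarrow> inv\<^bsub>real_field\<^esub> x = inverse x"
  by (rule comm_monoid.comm_inv_char)
     (simp_all add: real_field_simps cring.axioms(2) cring_from_type_algebra)

text \<open>Coefficient lists on the \<open>ring.eval\<close> side start with the leading
  coefficient, on the \<open>Poly\<close> side with the constant one; hence the reversal.\<close>

lemma poly_Poly_rev: "poly (Poly (rev p)) x = ring.eval real_field p x"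
  by (induction p)
     (auto simp: ring.eval.simps[OF ring_from_type_algebra] Poly_snoc poly_monom real_field_simps real_field_power)

lemma number_field_algebraic:
  assumes "subfield F real_field" "ring.finite_dimension real_field \<rat> F" "x \<in> F"
  shows "algebraic x"
proof -
  interpret real_field: Ring.field real_field by (rule field_from_type_algebra)
  have sr: "subring \<rat> real_field"
    by (rule real_field.subringI) (auto simp: real_field_simps real_field_a_inv)
  have rat: "subfield \<rat> real_field"
    by (rule real_field.subfieldI'[OF sr]) (auto simp: real_field_simps real_field_m_inv)
  have F: "subring F real_field" using assms(1) by (rule subfieldE)
  have x: "x \<in> carrier real_field" by (simp add: real_field_simps)
  obtain p where p: "p \<in> carrier (\<rat>[X]\<^bsub>real_field\<^esub>)" "p \<noteq> []" "ring.eval real_field p x = 0"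
    using real_field.algebraicE[OF sr x real_field.finite_dimension_imp_algebraic[OF rat F assms(2,3)]]
    by (auto simp: real_field_simps)
  have P: "set p \<subseteq> \<rat>" "hd p \<noteq> 0"
    using p(1,2) by (auto simp: univ_poly_carrier[symmetric] polynomial_def real_field_simps)
  show ?thesis
  proof (rule algebraicI')
    show "poly (Poly (rev p)) x = 0" using p(3) by (simp add: poly_Poly_rev)
    have "hd p = Polynomial.coeff (Poly (rev p)) (length p - 1)"
      using p(2) by (simp add: coeff_Poly_eq nth_default_def rev_nth hd_conv_nth)
    then show "Poly (rev p) \<noteq> 0" using P(2) by (metis coeff_0)
    show "Polynomial.coeff (Poly (rev p)) i \<in> \<rat>" for i
      using P(1) nth_mem[of i "rev p"] by (auto simp: coeff_Poly_eq nth_default_def)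
  qed
qed

section \<open>Orders in quaternion algebras\<close>

fun quat_power :: "real \<Rightarrow> real \<Rightarrow> quat \<Rightarrow> nat \<Rightarrow> quat" where
  "quat_power a b x 0 = quat_one"
| "quat_power a b x (Suc n) = quat_mult a b x (quat_power a b x n)"

fun matrix_power :: "real^2^2 \<Rightarrow> nat \<Rightarrow> real^2^2" where
  "matrix_power A 0 = mat 1"
| "matrix_power A (Suc n) = A ** matrix_power A n"

lemma matrix_power_add: "matrix_power A (m + n) = matrix_power A m ** matrix_power A n"
  by (induction m) (simp_all add: matrix_mul_assoc)

lemma matrix_power_power: "matrix_power A (m * n) = matrix_power (matrix_power A m) n"
  by (induction n) (simp_all add: matrix_power_add)

lemma det_matrix_power: "det (matrix_power A n) = det A ^ n"
  by (induction n) (simp_all add: det_mul)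

lemma matrix_power_intertwine:
  assumes "A ** Y = Y ** B"
  shows "matrix_power A n ** Y = Y ** matrix_power B n"
proof (induction n)
  case (Suc n)
  have "matrix_power A (Suc n) ** Y = A ** (Y ** matrix_power B n)"
    by (simp add: Suc flip: matrix_mul_assoc)
  also have "\<dots> = Y ** matrix_power B (Suc n)" by (simp add: matrix_mul_assoc assms)
  finally show ?case .
qed simp

lemma quat_mult_one [simp]: "quat_mult a b quat_one x = x" "quat_mult a b x quat_one = x"
  by (cases x; simp add: quat_one_def)+

lemma quat_mult_add:
  "quat_mult a b (x + y) z = quat_mult a b x z + quat_mult a b y z"
  "quat_mult a b z (x + y) = quat_mult a b z x + quat_mult a b z y"
  by (cases x; cases y; cases z; simp add: algebra_simps)+

lemma quat_mult_diff:
  "quat_mult a b (x - y) z = quat_mult a b x z - quat_mult a b y z"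
  "quat_mult a b z (x - y) = quat_mult a b z x - quat_mult a b z y"
  by (cases x; cases y; cases z; simp add: algebra_simps)+

lemma quat_mult_scaleR:
  "quat_mult a b (r *\<^sub>R x) z = r *\<^sub>R quat_mult a b x z"
  "quat_mult a b z (r *\<^sub>R x) = r *\<^sub>R quat_mult a b z x"
  by (cases x; cases z; simp add: algebra_simps)+

lemma quat_conj_mult: "quat_mult a b (quat_conj x) x = quat_norm a b x *\<^sub>R quat_one"
  by (cases x) (simp add: quat_one_def power2_eq_square algebra_simps)

lemma quat_add_conj: "x + quat_conj x = (2 * fst x) *\<^sub>R quat_one"
  by (cases x) (simp add: quat_one_def)

lemma quat_norm_mult: "quat_norm a b (quat_mult a b x y) = quat_norm a b x * quat_norm a b y"
  by (cases x; cases y) (simp add: power2_eq_square algebra_simps)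

lemma quat_norm_one [simp]: "quat_norm a b quat_one = 1"
  by (simp add: quat_one_def)

lemma quat_norm_power: "quat_norm a b (quat_power a b x n) = quat_norm a b x ^ n"
  by (induction n) (simp_all add: quat_norm_mult)

lemma quat_power_inverse:
  assumes "quat_mult a b x y = quat_one" "quat_mult a b y x = quat_one"
  shows "quat_mult a b (quat_power a b x n) (quat_power a b y n) = quat_one"
proof -
  have comm: "quat_mult a b (quat_power a b z n) z = quat_mult a b z (quat_power a b z n)" for z n
    by (induction n) (simp_all add: quat_mult_assoc)
  show ?thesis
  proof (induction n)
    case (Suc n)
    have "quat_mult a b (quat_power a b x (Suc n)) (quat_power a b y (Suc n)) =
        quat_mult a b (quat_power a b x n) (quat_mult a b (quat_mult a b x y) (quat_power a b y n))"
      by (simp add: comm[of x n, symmetric]) (simp add: quat_mult_assoc)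
    then show ?case by (simp add: assms Suc)
  qed simp
qed

text \<open>The coefficient of 1 is minus the previous Chebyshev value. Writing it through the next
  value keeps the formula meaningful at \<open>k = 0\<close>.\<close>

lemma quat_power_chebyshev:
  assumes "quat_mult a b v v = t *\<^sub>R v - quat_one"
  shows "quat_power a b v k = chebyshev_U t k *\<^sub>R v + (chebyshev_U t (Suc k) - t * chebyshev_U t k) *\<^sub>R quat_one"
proof (induction k)
  case (Suc k)
  show ?case
    by (simp add: Suc quat_mult_add quat_mult_scaleR assms) (simp add: algebra_simps)
qed simp

lemma combinationsI: "(\<And>x. x \<in> B \<Longrightarrow> c x \<in> S) \<Longrightarrow> (\<Sum>x\<in>B. c x *\<^sub>R x) \<in> combinations S B"
  by (auto simp: combinations_def)

locale quaternion_order_splitting =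
  fixes F :: "real set" and a b :: real and \<sigma> :: "real \<Rightarrow> real" and R :: "quat set"
    and \<phi> :: "quat \<Rightarrow> real^2^2"
  assumes subfield: "subfield F real_field"
    and finite_dim: "ring.finite_dimension real_field \<rat> F"
    and a_mem: "a \<in> F" and b_mem: "b \<in> F"
    and place: "\<sigma> \<in> real_places F"
    and order: "quat_order F a b R"
    and iso: "quat_matrix_iso (\<sigma> a) (\<sigma> b) \<phi>"
begin

lemma subring_F: "subring F real_field" using subfield by (rule subfieldE)

lemma F_closed:
  "0 \<in> F" "1 \<in> F" "x \<in> F \<Longrightarrow> y \<in> F \<Longrightarrow> x + y \<in> F" "x \<in> F \<Longrightarrow> - x \<in> F"
  "x \<in> F \<Longrightarrow> y \<in> F \<Longrightarrow> x * y \<in> F" "x \<in> F \<Longrightarrow> y \<in> F \<Longrightarrow> x - y \<in> F"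
proof -
  note s = subringE[OF subring_F, unfolded real_field_simps real_field_a_inv]
  show "0 \<in> F" "1 \<in> F" "x \<in> F \<Longrightarrow> y \<in> F \<Longrightarrow> x + y \<in> F" "x \<in> F \<Longrightarrow> - x \<in> F"
    "x \<in> F \<Longrightarrow> y \<in> F \<Longrightarrow> x * y \<in> F"
    using s by auto
  show "x \<in> F \<Longrightarrow> y \<in> F \<Longrightarrow> x - y \<in> F"
    using s(5)[of y] s(7)[of x "- y"] by auto
qed

lemma F_inverse: "x \<in> F \<Longrightarrow> inverse x \<in> F"
  using ring.subfield_m_inv(1)[OF ring_from_type_algebra subfield, of x]
  by (cases "x = 0") (auto simp: real_field_simps real_field_m_inv)

lemma F_of_int: "of_int k \<in> F"
  by (induction k rule: int_induct[of _ 0]) (auto intro: F_closed)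

lemma F_Rats: "q \<in> \<rat> \<Longrightarrow> q \<in> F"
  by (elim Rats_cases') (auto simp: divide_inverse intro!: F_closed F_inverse F_of_int)

lemma place_hom:
  "x \<in> F \<Longrightarrow> y \<in> F \<Longrightarrow> \<sigma> (x + y) = \<sigma> x + \<sigma> y"
  "x \<in> F \<Longrightarrow> y \<in> F \<Longrightarrow> \<sigma> (x * y) = \<sigma> x * \<sigma> y"
  "\<sigma> 1 = 1"
  using place by (auto simp: real_places_def ring_hom_def real_field_simps)

lemma place_0: "\<sigma> 0 = 0"
  using place_hom(1)[of 0 0] F_closed(1) by simp

lemma place_minus: "x \<in> F \<Longrightarrow> \<sigma> (- x) = - \<sigma> x"
  using place_hom(1)[of x "- x"] by (simp add: F_closed place_0)

lemma place_diff: "x \<in> F \<Longrightarrow> y \<in> F \<Longrightarrow> \<sigma> (x - y) = \<sigma> x - \<sigma> y"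
  using place_hom(1)[of x "- y"] by (simp add: F_closed place_minus)

lemma place_of_int: "\<sigma> (of_int k) = of_int k"
  by (induction k rule: int_induct[of _ 0]) (simp_all add: place_0 place_hom place_diff F_closed F_of_int)

text \<open>The property that lets a rational perturbation parameter pass through
  \<open>\<sigma>\<close> unchanged.\<close>

lemma place_Rats: "q \<in> \<rat> \<Longrightarrow> \<sigma> q = q"
proof (elim Rats_cases')
  fix m n :: int assume q: "q = of_int m / of_int n" "n > 0"
  then have "q \<in> F" by (simp add: F_Rats)
  then have "\<sigma> (q * of_int n) = \<sigma> q * of_int n" by (simp add: place_hom F_of_int place_of_int)
  moreover have qn: "q * of_int n = of_int m" using q by simp
  ultimately have "\<sigma> q * of_int n = q * of_int n" by (simp only: qn place_of_int)
  then show ?thesis using q(2) by simp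
qed

lemma quat_map_mult:
  assumes "x \<in> quat_points F" "y \<in> quat_points F"
  shows "quat_map \<sigma> (quat_mult a b x y) = quat_mult (\<sigma> a) (\<sigma> b) (quat_map \<sigma> x) (quat_map \<sigma> y)"
  using assms a_mem b_mem
  by (cases x; cases y) (simp add: quat_points_def place_hom place_diff F_closed)

text \<open>Multiplicative on \<open>quat_points F\<close> only, since \<open>\<sigma>\<close>
  respects the operations just inside \<open>F\<close>.\<close>

definition rep :: "quat \<Rightarrow> real^2^2" where
  "rep x = \<phi> (quat_map \<sigma> x)"

lemma rep_mult:
  "x \<in> quat_points F \<Longrightarrow> y \<in> quat_points F \<Longrightarrow> rep (quat_mult a b x y) = rep x ** rep y"
  unfolding rep_def using iso[unfolded quat_matrix_iso_def] by (simp only: quat_map_mult)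

lemma rep_one: "rep quat_one = mat 1"
proof -
  have "quat_map \<sigma> quat_one = quat_one" by (simp add: quat_one_def place_0 place_hom)
  then show ?thesis using iso by (simp add: rep_def quat_matrix_iso_def)
qed

lemma quat_points_closed:
  "quat_one \<in> quat_points F"
  "x \<in> quat_points F \<Longrightarrow> y \<in> quat_points F \<Longrightarrow> quat_mult a b x y \<in> quat_points F"
  "x \<in> quat_points F \<Longrightarrow> quat_conj x \<in> quat_points F"
  "x \<in> quat_points F \<Longrightarrow> r \<in> F \<Longrightarrow> r *\<^sub>R x \<in> quat_points F"
  using a_mem b_mem
  by (cases x; cases y; auto simp: quat_points_def quat_one_def intro!: F_closed)+

lemma quat_norm_mem: "x \<in> quat_points F \<Longrightarrow> quat_norm a b x \<in> F"
  using a_mem b_mem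
  by (cases x) (auto simp: quat_points_def power2_eq_square intro!: F_closed)

text \<open>No formula relating \<open>det\<close> and \<open>quat_norm\<close> is used. If the norm
  vanished, the invertible matrix \<open>rep x\<close> would annihilate the image of the conjugate;
  injectivity of \<open>\<phi>\<close> then kills the transported coordinates of the conjugate,
  hence those of \<open>x\<close>, so \<open>rep x\<close> would be 0.\<close>

lemma quat_norm_nonzero:
  assumes "x \<in> quat_points F" "det (rep x) \<noteq> 0"
  shows "quat_norm a b x \<noteq> 0"
proof
  assume "quat_norm a b x = 0"
  then have xc: "quat_mult a b x (quat_conj x) = 0" by (simp add: quat_mult_conj)
  have lin: "linear \<phi>" "bij \<phi>" using iso by (auto simp: quat_matrix_iso_def)
  have \<phi>0: "\<phi> z = 0 \<Longrightarrow> z = 0" for z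
    using lin linear_0[OF lin(1)] by (metis bij_pointE)
  have "rep x ** rep (quat_conj x) = rep 0"
    using rep_mult[of x "quat_conj x"] xc assms by (simp add: quat_points_closed)
  also have "quat_map \<sigma> 0 = 0" by (simp add: zero_prod_def place_0)
  then have "rep 0 = 0" using linear_0[OF lin(1)] by (simp only: rep_def)
  finally have 0: "rep x ** rep (quat_conj x) = 0" .
  obtain B where B: "B ** rep x = mat 1"
    using assms(2) by (metis invertible_det_nz invertible_def)
  have "rep (quat_conj x) = (B ** rep x) ** rep (quat_conj x)" by (simp add: B)
  also have "\<dots> = B ** (rep x ** rep (quat_conj x))" by (simp only: matrix_mul_assoc)
  also have "\<dots> = 0" unfolding 0 by simp
  finally have "quat_map \<sigma> (quat_conj x) = 0" by (intro \<phi>0) (simp add: rep_def)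
  then have "quat_map \<sigma> x = 0"
    using assms(1) by (cases x) (auto simp: quat_points_def place_minus zero_prod_def)
  then have "rep x = 0" using lin by (simp add: rep_def linear_0)
  then show False using assms(2) by (simp add: det_2)
qed

lemma order_closed:
  "quat_one \<in> R" "x \<in> R \<Longrightarrow> y \<in> R \<Longrightarrow> quat_mult a b x y \<in> R"
  using order by (auto simp: quat_order_def)

lemma ring_of_integers_closed:
  "0 \<in> ring_of_integers F"
  "x \<in> ring_of_integers F \<Longrightarrow> y \<in> ring_of_integers F \<Longrightarrow> x + y \<in> ring_of_integers F"
  "x \<in> ring_of_integers F \<Longrightarrow> - x \<in> ring_of_integers F"
  by (auto simp: ring_of_integers_def F_closed algebraic_int_plus)

lemma order_basis:
  obtains B where "finite B" "R = combinations (ring_of_integers F) B" "quat_points F = combinations F B"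
  using order by (auto simp: quat_order_def)

lemma order_quat_points: "x \<in> R \<Longrightarrow> x \<in> quat_points F"
proof -
  obtain B where B: "R = combinations (ring_of_integers F) B" "quat_points F = combinations F B"
    by (rule order_basis)
  have "combinations (ring_of_integers F) B \<subseteq> combinations F B"
    by (auto simp: combinations_def ring_of_integers_def)
  then show "x \<in> R \<Longrightarrow> x \<in> quat_points F" using B by auto
qed

lemma order_add: "x \<in> R \<Longrightarrow> y \<in> R \<Longrightarrow> x + y \<in> R"
proof -
  assume xy: "x \<in> R" "y \<in> R"
  obtain B where B: "R = combinations (ring_of_integers F) B" by (rule order_basis)
  obtain c d where "x = (\<Sum>z\<in>B. c z *\<^sub>R z)" "y = (\<Sum>z\<in>B. d z *\<^sub>R z)"
    and cd: "\<And>z. z \<in> B \<Longrightarrow> c z \<in> ring_of_integers F" "\<And>z. z \<in> B \<Longrightarrow> d z \<in> ring_of_integers F"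
    using xy by (auto simp: B combinations_def)
  then have "x + y = (\<Sum>z\<in>B. (c z + d z) *\<^sub>R z)" by (simp add: sum.distrib scaleR_left_distrib)
  also have "\<dots> \<in> R" unfolding B using cd by (intro combinationsI ring_of_integers_closed)
  finally show ?thesis .
qed

lemma order_minus: "x \<in> R \<Longrightarrow> - x \<in> R"
proof -
  assume x: "x \<in> R"
  obtain B where B: "R = combinations (ring_of_integers F) B" by (rule order_basis)
  obtain c where "x = (\<Sum>z\<in>B. c z *\<^sub>R z)"
    and c: "\<And>z. z \<in> B \<Longrightarrow> c z \<in> ring_of_integers F"
    using x by (auto simp: B combinations_def)
  then have "- x = (\<Sum>z\<in>B. (- c z) *\<^sub>R z)" by (simp add: sum_negf)
  also have "\<dots> \<in> R" unfolding B using c by (intro combinationsI ring_of_integers_closed)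
  finally show ?thesis .
qed

lemma order_diff: "x \<in> R \<Longrightarrow> y \<in> R \<Longrightarrow> x - y \<in> R"
  using order_add[of x "- y"] order_minus by simp

lemma order_of_int: "x \<in> R \<Longrightarrow> of_int k *\<^sub>R x \<in> R"
proof -
  assume x: "x \<in> R"
  show "of_int k *\<^sub>R x \<in> R"
  proof (induction k rule: int_induct[of _ 0])
    case base
    show ?case using order_diff[OF x x] by simp
  next
    case (step1 i)
    show ?case using order_add[OF step1(2) x] by (simp add: scaleR_left_distrib)
  next
    case (step2 i)
    show ?case using order_diff[OF step2(2) x] by (simp add: scaleR_left_diff_distrib)
  qed
qed

text \<open>Coordinates with respect to generators of the order are algebraic, and the product of
  their denominators clears all of them.\<close>

lemma order_multiple:
  assumes "z \<in> quat_points F"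
  obtains n :: nat where "n > 0" "real n *\<^sub>R z \<in> R"
proof -
  obtain B where B: "finite B" "R = combinations (ring_of_integers F) B" "quat_points F = combinations F B"
    by (rule order_basis)
  obtain c where z: "z = (\<Sum>x\<in>B. c x *\<^sub>R x)" and c: "\<And>x. x \<in> B \<Longrightarrow> c x \<in> F"
    using assms by (auto simp: B(3) combinations_def)
  have "\<forall>x\<in>B. \<exists>n::nat. n > 0 \<and> (\<forall>m. n dvd m \<longrightarrow> algebraic_int (real m * c x))"
  proof
    fix x assume "x \<in> B"
    then have "algebraic (c x)" using c number_field_algebraic[OF subfield finite_dim] by blast
    then obtain n :: nat where "n > 0" "\<And>m. n dvd m \<Longrightarrow> algebraic_int (real m * c x)"
      by (rule algebraic_imp_int_multiple) blast
    then show "\<exists>n::nat. n > 0 \<and> (\<forall>m. n dvd m \<longrightarrow> algebraic_int (real m * c x))" by blast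
  qed
  then obtain n :: "quat \<Rightarrow> nat" where n: "\<And>x. x \<in> B \<Longrightarrow> n x > 0"
    "\<And>x m. x \<in> B \<Longrightarrow> n x dvd m \<Longrightarrow> algebraic_int (real m * c x)" by metis
  show thesis
  proof (rule that[of "prod n B"])
    show "prod n B > 0" using n(1) by (simp add: prod_pos)
    have "real (prod n B) *\<^sub>R z = (\<Sum>x\<in>B. (real (prod n B) * c x) *\<^sub>R x)"
      unfolding z scaleR_sum_right by simp
    also have "\<dots> \<in> R"
      unfolding B(2)
    proof (rule combinationsI)
      fix x assume x: "x \<in> B"
      have "n x dvd prod n B" using B(1) x by (rule dvd_prodI)
      then have "algebraic_int (real (prod n B) * c x)" by (rule n(2)[OF x])
      moreover have "real (prod n B) * c x \<in> F"
        using F_closed(5)[OF F_of_int[of "int (prod n B)"] c[OF x]] by simp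
      ultimately show "real (prod n B) * c x \<in> ring_of_integers F"
        by (simp only: ring_of_integers_def mem_Collect_eq simp_thms)
    qed
    finally show "real (prod n B) *\<^sub>R z \<in> R" .
  qed
qed

lemma order_int_adjoin:
  assumes "t *\<^sub>R quat_one \<in> R" "c \<in> int_adjoin t" "x \<in> R"
  shows "c *\<^sub>R x \<in> R"
  using assms(2)
proof induction
  case zero
  show ?case using order_of_int[OF assms(3), of 0] by simp
next
  case (horner c k)
  have "(of_int k + t * c) *\<^sub>R x = of_int k *\<^sub>R x + quat_mult a b (t *\<^sub>R quat_one) (c *\<^sub>R x)"
    by (simp add: quat_mult_scaleR scaleR_left_distrib)
  then show ?case using order_add[OF order_of_int[OF assms(3)] order_closed(2)[OF assms(1) horner.IH]] by simp
qed

text \<open>Some power of \<open>v\<close> is congruent to 1 modulo a denominator of \<open>v\<close>.\<close>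

lemma order_unit_power:
  assumes "v \<in> quat_points F" "v + v' = t *\<^sub>R quat_one" "quat_mult a b v v' = quat_one"
    "quat_mult a b v' v = quat_one" "t *\<^sub>R quat_one \<in> R" "t \<in> F"
  obtains k where "k > 0" "quat_power a b v k \<in> R" "quat_power a b v' k \<in> R"
proof -
  obtain n where n: "n > 0" "real n *\<^sub>R v \<in> R" by (rule order_multiple[OF assms(1)])
  have "algebraic t" using number_field_algebraic[OF subfield finite_dim assms(6)] .
  from this n(1) obtain k c d where k: "k > 0" "c \<in> int_adjoin t" "d \<in> int_adjoin t"
    "chebyshev_U t k = real n * d" "chebyshev_U t (Suc k) = 1 + real n * c"
    by (rule chebyshev_U_periodic_mod)
  \<comment> \<open>Stated for a generic pair, because \<open>v\<close> and its inverse
    \<open>v'\<close> satisfy the same quadratic equation: one exponent \<open>k\<close> works for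
    both.\<close>
  have pow: "quat_power a b x k \<in> R"
    if x: "x + y = t *\<^sub>R quat_one" "quat_mult a b x y = quat_one" "real n *\<^sub>R x \<in> R" for x y
  proof -
    have "quat_mult a b x x = quat_mult a b x (t *\<^sub>R quat_one - y)" by (simp flip: x(1))
    also have "\<dots> = t *\<^sub>R x - quat_one" by (simp add: quat_mult_diff quat_mult_scaleR x(2))
    finally have sq: "quat_mult a b x x = t *\<^sub>R x - quat_one" .
    \<comment> \<open>The factor \<open>n\<close> of the \<open>k\<close>-th Chebyshev value is
      spent on the denominator of \<open>x\<close>. All other coefficients lie in
      \<open>int_adjoin t\<close>, which acts on the order.\<close>
    have "quat_power a b x k = d *\<^sub>R (real n *\<^sub>R x) +
        (of_int 1 + of_int (int n) * c - t * (of_int (int n) * d)) *\<^sub>R quat_one"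
      unfolding quat_power_chebyshev[OF sq] k(4,5) by (simp add: mult.commute)
    also have "\<dots> \<in> R"
      by (intro order_add order_int_adjoin[OF assms(5)] k x(3) order_closed(1)
          int_adjoin_diff int_adjoin_add int_adjoin_of_int int_adjoin_times int_adjoin_int_mult)
    finally show ?thesis .
  qed
  have "real n *\<^sub>R v' = of_int (int n) *\<^sub>R (t *\<^sub>R quat_one) - real n *\<^sub>R v"
    unfolding assms(2)[symmetric] by (simp add: algebra_simps)
  then have "real n *\<^sub>R v' \<in> R" using order_diff[OF order_of_int[OF assms(5), of "int n"] n(2)] by simp
  then show thesis
    using that[OF k(1)] pow[OF assms(2,3) n(2)] pow[of v' v] assms(2,4) by (simp add: add.commute)
qed

text \<open>Conjugation by \<open>x\<close> preserves trace and norm but may leave the order. A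
  suitable power of the conjugate returns to it, together with its inverse, and so is again a
  norm-one unit.\<close>

lemma norm_one_units_conjugate:
  assumes u: "u \<in> norm_one_units a b R" and x: "x \<in> quat_points F" "det (rep x) \<noteq> 0"
  obtains k w where "k > 0" "w \<in> norm_one_units a b R" "rep w ** rep x = rep x ** matrix_power (rep u) k"
proof -
  let ?m = "quat_mult a b"
  define n where "n = quat_norm a b x"
  have n: "n \<noteq> 0" "n \<in> F" using quat_norm_nonzero[OF x] quat_norm_mem[OF x(1)] by (auto simp: n_def)
  define xi where "xi = inverse n *\<^sub>R quat_conj x"
  have xi: "?m x xi = quat_one" "?m xi x = quat_one" "xi \<in> quat_points F"
    using n x(1) by (simp_all add: xi_def quat_mult_scaleR quat_mult_conj quat_conj_mult
        n_def[symmetric] quat_points_closed F_inverse)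
  obtain y where y: "u \<in> R" "quat_norm a b u = 1" "y \<in> R" "?m u y = quat_one" "?m y u = quat_one"
    using u by (auto simp: norm_one_units_def)
  have uF: "u \<in> quat_points F" using y(1) by (rule order_quat_points)
  define u' where "u' = quat_conj u"
  have uu': "?m u u' = quat_one" "?m u' u = quat_one" 
    by (simp_all add: u'_def quat_mult_conj quat_conj_mult y(2))
  \<comment> \<open>The conjugate of \<open>u\<close> is its inverse and thus lies in the order;
    this puts the trace, as a scalar quaternion, into the order.\<close>
  have "u' = ?m (?m y u) u'" by (simp add: y)
  also have "\<dots> = y" by (simp add: quat_mult_assoc uu')
  finally have "u' \<in> R" using y by simp
  define t where "t = 2 * fst u"
  have ut: "u + u' = t *\<^sub>R quat_one" by (simp add: u'_def t_def quat_add_conj)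
  then have tR: "t *\<^sub>R quat_one \<in> R" using order_add[OF y(1) \<open>u' \<in> R\<close>] by simp
  have "fst u \<in> F" using uF by (cases u) (simp add: quat_points_def)
  then have tF: "t \<in> F" using F_closed(3)[of "fst u" "fst u"] by (simp add: t_def)
  define v v' where "v = ?m (?m x u) xi" and "v' = ?m (?m x u') xi"
  have cancel: "?m xi (?m x z) = z" "?m u (?m u' z) = z" "?m u' (?m u z) = z" for z
    unfolding quat_mult_assoc[symmetric] xi uu' by simp_all
  have vF: "v \<in> quat_points F" by (simp add: v_def quat_points_closed x uF xi)
  have "v + v' = ?m (?m x (u + u')) xi" by (simp add: v_def v'_def quat_mult_add)
  also have "\<dots> = t *\<^sub>R quat_one" unfolding ut by (simp add: quat_mult_scaleR xi)
  finally have vt: "v + v' = t *\<^sub>R quat_one" .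
  have vv': "?m v v' = quat_one" "?m v' v = quat_one"
    by (simp_all add: v_def v'_def quat_mult_assoc cancel xi)
  from order_unit_power[OF vF vt vv' tR tF] obtain k where
    k: "k > 0" "quat_power a b v k \<in> R" "quat_power a b v' k \<in> R" .
  have "quat_norm a b v = quat_norm a b (?m x xi)"
    by (simp add: v_def quat_norm_mult y(2))
  then have "quat_norm a b (quat_power a b v k) = 1" by (simp add: quat_norm_power xi)
  then have w: "quat_power a b v k \<in> norm_one_units a b R"
    unfolding norm_one_units_def using k quat_power_inverse[OF vv'] quat_power_inverse[OF vv'(2,1)] by blast
  have pF: "quat_power a b z m \<in> quat_points F" if "z \<in> quat_points F" for z m
    using that by (induction m) (simp_all add: quat_points_closed)
  have rp: "rep (quat_power a b z m) = matrix_power (rep z) m" if "z \<in> quat_points F" for z m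
    using that by (induction m) (simp_all add: rep_one rep_mult pF)
  have "?m v x = ?m x u" by (simp add: v_def quat_mult_assoc xi)
  then have "rep v ** rep x = rep x ** rep u" using rep_mult vF x uF by metis
  then have "rep (quat_power a b v k) ** rep x = rep x ** matrix_power (rep u) k"
    by (simp add: rp vF matrix_power_intertwine)
  with k(1) w show thesis using that by blast
qed

lemma norm_one_units_closed:
  assumes "x \<in> norm_one_units a b R" "y \<in> norm_one_units a b R"
  shows "quat_mult a b x y \<in> norm_one_units a b R"
proof -
  let ?m = "quat_mult a b"
  obtain x' y' where "x \<in> R" "x' \<in> R" "?m x x' = quat_one" "?m x' x = quat_one"
    "y \<in> R" "y' \<in> R" "?m y y' = quat_one" "?m y' y = quat_one" "quat_norm a b x = 1" "quat_norm a b y = 1"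
    using assms by (auto simp: norm_one_units_def)
  moreover from this have "?m (?m x y) (?m y' x') = quat_one" "?m (?m y' x') (?m x y) = quat_one"
    by (metis quat_mult_assoc quat_mult_one(1))+
  ultimately show ?thesis
    by (auto simp: norm_one_units_def quat_norm_mult intro!: order_closed bexI[of _ "?m y' x'"])
qed

lemma norm_one_units_one: "quat_one \<in> norm_one_units a b R"
  using order_closed(1) by (auto simp: norm_one_units_def intro!: bexI[of _ quat_one])

end

section \<open>Commensurability\<close>

definition psl_class :: "real^2^2 \<Rightarrow> (real^2^2) set" where
  "psl_class A = {A, - A}"

lemma r_coset_SL2R: "{mat 1, - mat 1} #>\<^bsub>SL2R\<^esub> A = psl_class A"
  by (auto simp: r_coset_def SL2R_def psl_class_def matrix_mul_minus_left)

lemma carrier_PSL2R: "carrier PSL2R = psl_class ` {A. det A = 1}"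
  by (auto simp: PSL2R_def FactGroup_def RCOSETS_def r_coset_SL2R) (auto simp: SL2R_def r_coset_SL2R)

lemma one_PSL2R: "\<one>\<^bsub>PSL2R\<^esub> = psl_class (mat 1)"
  by (simp add: PSL2R_def FactGroup_def psl_class_def)

lemma mult_PSL2R: "psl_class A \<otimes>\<^bsub>PSL2R\<^esub> psl_class B = psl_class (A ** B)"
  by (auto simp: PSL2R_def FactGroup_def set_mult_def SL2R_def psl_class_def
      matrix_mul_minus_left matrix_mul_minus_right)

lemma psl_class_eq_iff: "psl_class A = psl_class B \<longleftrightarrow> A = B \<or> A = - B"
  by (auto simp: psl_class_def doubleton_eq_iff)

lemma psl_class_carrier: "det A = 1 \<Longrightarrow> psl_class A \<in> carrier PSL2R"
  by (auto simp: carrier_PSL2R)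

lemma psl_class_memD: "P \<in> carrier PSL2R \<Longrightarrow> A \<in> P \<Longrightarrow> P = psl_class A \<and> det A = 1"
  by (auto simp: carrier_PSL2R psl_class_def det_2)

lemma inv_PSL2R:
  assumes "A ** B = mat 1" "B ** A = mat 1" "det A = 1" "det B = 1"
  shows "inv\<^bsub>PSL2R\<^esub> (psl_class A) = psl_class B"
  using assms by (intro group.inv_equality group_PSL2R) (simp_all add: mult_PSL2R one_PSL2R psl_class_carrier)

lemma inverse_matrix_det_1:
  assumes "det (A :: real^2^2) = 1"
  obtains B where "A ** B = mat 1" "B ** A = mat 1" "det B = 1"
proof -
  obtain B where B: "A ** B = mat 1" "B ** A = mat 1"
    using assms by (metis invertible_def invertible_det_nz zero_neq_one)
  moreover have "det A * det B = 1" using B(1) by (metis det_I det_mul)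
  ultimately show thesis using that assms by simp
qed

lemma fuchsian_group_mem_iff:
  assumes "subgroup \<Gamma> PSL2R"
  shows "A \<in> \<Union>\<Gamma> \<longleftrightarrow> det A = 1 \<and> psl_class A \<in> \<Gamma>"
proof -
  have "P \<in> \<Gamma> \<Longrightarrow> P \<in> carrier PSL2R" for P using assms subgroup.subset by blast
  then show ?thesis
    using psl_class_memD by (auto simp: psl_class_def)
qed

lemma fuchsian_group_discrete_matrix_group:
  assumes "fuchsian_group \<Gamma>"
  shows "discrete_matrix_group \<Gamma>"
proof
  have sg: "subgroup \<Gamma> PSL2R" and d: "discrete (\<Union>\<Gamma>)" using assms by (auto simp: fuchsian_group_def)
  note iff = fuchsian_group_mem_iff[OF sg]
  show "discrete (\<Union>\<Gamma>)" by (rule d)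
  show "mat 1 \<in> \<Union>\<Gamma>" unfolding iff using subgroup.one_closed[OF sg] by (simp add: one_PSL2R)
  fix A assume A: "A \<in> \<Union>\<Gamma>"
  then show det: "det A = 1" unfolding iff by simp
  show "A ** B \<in> \<Union>\<Gamma>" if "B \<in> \<Union>\<Gamma>" for B
    using A that subgroup.m_closed[OF sg, of "psl_class A" "psl_class B"]
    unfolding iff by (simp add: mult_PSL2R det_mul)
  obtain B where B: "A ** B = mat 1" "B ** A = mat 1" "det B = 1"
    using inverse_matrix_det_1[OF det] .
  have "psl_class B \<in> \<Gamma>"
    using subgroup.m_inv_closed[OF sg, of "psl_class A"] A det B inv_PSL2R[of A B] unfolding iff by simp
  then show "\<exists>B\<in>\<Union>\<Gamma>. A ** B = mat 1 \<and> B ** A = mat 1"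
    using B iff by blast
qed

text \<open>Pigeonhole on the cosets of the powers of \<open>A\<close>: when the \<open>i\<close>-th
  and \<open>j\<close>-th powers share a coset, their quotient lies in \<open>N\<close>.\<close>

lemma power_in_finite_index:
  assumes fin: "finite (rcosets\<^bsub>PSL2R\<lparr>carrier := H\<rparr>\<^esub> N)"
    and N: "N \<subseteq> carrier PSL2R" "\<one>\<^bsub>PSL2R\<^esub> \<in> N"
    and A: "det A = 1" "\<And>n. psl_class (matrix_power A n) \<in> H"
  obtains k where "k > 0" "psl_class (matrix_power A k) \<in> N"
proof -
  interpret P: group PSL2R by (rule group_PSL2R)
  let ?p = "\<lambda>n. psl_class (matrix_power A n)"
  have car: "?p n \<in> carrier PSL2R" for n by (simp add: psl_class_carrier det_matrix_power A)
  let ?f = "\<lambda>n. N #>\<^bsub>PSL2R\<lparr>carrier := H\<rparr>\<^esub> ?p n"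
  have "range ?f \<subseteq> rcosets\<^bsub>PSL2R\<lparr>carrier := H\<rparr>\<^esub> N" using A(2) by (auto simp: RCOSETS_def)
  then have "finite (range ?f)" using fin by (rule finite_subset)
  then have "\<not> inj ?f" using finite_imageD infinite_UNIV_nat by blast
  then obtain i j where ij: "i < j" "?f i = ?f j" by (auto simp: inj_on_def) (metis linorder_neqE_nat)
  have "?p j \<in> ?f j" using N(2) car by (auto simp: r_coset_def intro!: bexI[of _ "\<one>\<^bsub>PSL2R\<^esub>"])
  then have "?p j \<in> ?f i" using ij(2) by simp
  then obtain s where s: "s \<in> N" "?p j = s \<otimes>\<^bsub>PSL2R\<^esub> ?p i" by (auto simp: r_coset_def)
  have "?p j = ?p (j - i) \<otimes>\<^bsub>PSL2R\<^esub> ?p i"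
    using ij(1) by (simp add: mult_PSL2R flip: matrix_power_add)
  moreover have "s \<in> carrier PSL2R" using s(1) N(1) by blast
  ultimately have "s = ?p (j - i)" using s(2) car P.right_cancel[of "?p i" s "?p (j - i)"] by simp
  then show thesis using that[of "j - i"] s(1) ij(1) by simp
qed

lemma matrix_power_conjugate:
  assumes "G' ** G = mat 1" "G ** G' = mat 1"
  shows "matrix_power (G ** A ** G') n = G ** matrix_power A n ** G'"
proof -
  have "(G ** A ** G') ** G = G ** A" by (simp add: assms flip: matrix_mul_assoc)
  then have "matrix_power (G ** A ** G') n ** G = G ** matrix_power A n" by (rule matrix_power_intertwine)
  then show ?thesis using assms(2) by (metis matrix_mul_assoc matrix_mul_rid)
qed

text \<open>\<open>G\<close> is a matrix representing the conjugating element of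
  \<open>PSL2R\<close>, and \<open>G'\<close> is its inverse.\<close>

locale arithmetic_group = quaternion_order_splitting F a b \<sigma> R \<phi>
  for F :: "real set" and a b :: real and \<sigma> :: "real \<Rightarrow> real" and R :: "quat set"
    and \<phi> :: "quat \<Rightarrow> real^2^2" +
  fixes \<Gamma> :: "(real^2^2) set set" and G G' :: "real^2^2"
  assumes sub: "subgroup \<Gamma> PSL2R"
    and G: "G ** G' = mat 1" "G' ** G = mat 1" "det G = 1" "det G' = 1"
    and comm: "commensurable PSL2R
      (psl_class G <#\<^bsub>PSL2R\<^esub> \<Gamma> #>\<^bsub>PSL2R\<^esub> (inv\<^bsub>PSL2R\<^esub> (psl_class G)))
      ((\<lambda>x. {mat 1, - mat 1} #>\<^bsub>SL2R\<^esub> \<phi> (quat_map \<sigma> x)) ` norm_one_units a b R)"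
begin

definition conjugate_group :: "(real^2^2) set set" where
  "conjugate_group = psl_class G <#\<^bsub>PSL2R\<^esub> \<Gamma> #>\<^bsub>PSL2R\<^esub> (inv\<^bsub>PSL2R\<^esub> (psl_class G))"

definition unit_group :: "(real^2^2) set set" where
  "unit_group = (\<lambda>x. psl_class (rep x)) ` norm_one_units a b R"

lemma commensurable_groups: "commensurable PSL2R conjugate_group unit_group"
  using comm by (simp add: conjugate_group_def unit_group_def rep_def r_coset_SL2R)

lemma conjugate_group_eq: "conjugate_group = (\<lambda>A. psl_class (G ** A ** G')) ` \<Union>\<Gamma>"
proof -
  have "conjugate_group = (\<lambda>P. psl_class G \<otimes>\<^bsub>PSL2R\<^esub> P \<otimes>\<^bsub>PSL2R\<^esub> psl_class G') ` \<Gamma>"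
    unfolding conjugate_group_def inv_PSL2R[OF G] by (auto simp: l_coset_def r_coset_def)
  moreover have "psl_class ` \<Union>\<Gamma> = \<Gamma>"
  proof
    show "psl_class ` \<Union>\<Gamma> \<subseteq> \<Gamma>" using fuchsian_group_mem_iff[OF sub] by auto
    show "\<Gamma> \<subseteq> psl_class ` \<Union>\<Gamma>"
    proof
      fix P assume P: "P \<in> \<Gamma>"
      then have "P \<in> carrier PSL2R" using sub subgroup.subset by blast
      then obtain A where A: "P = psl_class A" by (auto simp: carrier_PSL2R)
      then have "A \<in> \<Union>\<Gamma>" using P by (auto simp: psl_class_def)
      then show "P \<in> psl_class ` \<Union>\<Gamma>" using A by blast
    qed
  qed
  ultimately have "conjugate_group =
      (\<lambda>P. psl_class G \<otimes>\<^bsub>PSL2R\<^esub> P \<otimes>\<^bsub>PSL2R\<^esub> psl_class G') ` (psl_class ` \<Union>\<Gamma>)"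
    by simp
  then show ?thesis by (simp only: image_image mult_PSL2R)
qed

lemma conjugate_group_subset: "conjugate_group \<subseteq> carrier PSL2R"
  unfolding conjugate_group_eq
proof (rule image_subsetI)
  fix A assume "A \<in> \<Union>\<Gamma>"
  then have "det A = 1" using fuchsian_group_mem_iff[OF sub] by blast
  then show "psl_class (G ** A ** G') \<in> carrier PSL2R" by (simp add: psl_class_carrier det_mul G)
qed

lemma one_conjugate_group: "\<one>\<^bsub>PSL2R\<^esub> \<in> conjugate_group"
proof -
  have "mat 1 \<in> \<Union>\<Gamma>"
    unfolding fuchsian_group_mem_iff[OF sub] using subgroup.one_closed[OF sub] by (simp add: one_PSL2R)
  then show ?thesis
    unfolding conjugate_group_eq by (rule rev_image_eqI) (simp add: one_PSL2R G)
qed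

lemma one_unit_group: "\<one>\<^bsub>PSL2R\<^esub> \<in> unit_group"
  unfolding unit_group_def
  using norm_one_units_one by (rule rev_image_eqI) (simp add: one_PSL2R rep_one)

section \<open>Powers shared by the two commensurable groups\<close>

lemma rep_norm_one_units_mult:
  "x \<in> norm_one_units a b R \<Longrightarrow> y \<in> norm_one_units a b R \<Longrightarrow> rep (quat_mult a b x y) = rep x ** rep y"
  by (auto simp: norm_one_units_def intro!: rep_mult order_quat_points)

lemma norm_one_units_power:
  assumes "x \<in> norm_one_units a b R"
  shows "\<exists>y\<in>norm_one_units a b R. rep y = matrix_power (rep x) n"
proof (induction n)
  case 0
  show ?case using norm_one_units_one rep_one by auto
next
  case (Suc n)
  then show ?case
    using rep_norm_one_units_mult[OF assms] norm_one_units_closed[OF assms] by fastforce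
qed

lemma group_power:
  assumes "A \<in> \<Union>\<Gamma>"
  shows "matrix_power A n \<in> \<Union>\<Gamma>"
proof (induction n)
  case 0
  show ?case
    unfolding fuchsian_group_mem_iff[OF sub] using subgroup.one_closed[OF sub] by (simp add: one_PSL2R)
next
  case (Suc n)
  then show ?case
    using assms subgroup.m_closed[OF sub, of "psl_class A" "psl_class (matrix_power A n)"]
    unfolding fuchsian_group_mem_iff[OF sub] by (simp add: mult_PSL2R det_mul)
qed

lemma group_element_power_unit:
  assumes "A \<in> \<Union>\<Gamma>"
  obtains k u where "k > 0" "u \<in> norm_one_units a b R" "G ** matrix_power A k ** G' = rep u"
proof -
  let ?B = "G ** A ** G'"
  have "det A = 1" using assms fuchsian_group_mem_iff[OF sub] by blast
  then have "det ?B = 1" by (simp add: det_mul G)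
  have pow: "psl_class (matrix_power ?B n) \<in> conjugate_group" for n
    unfolding conjugate_group_eq matrix_power_conjugate[OF G(2,1)]
    by (rule imageI) (rule group_power[OF assms])
  obtain k where k: "k > 0" "psl_class (matrix_power ?B k) \<in> conjugate_group \<inter> unit_group"
  proof (rule power_in_finite_index[OF _ _ _ \<open>det ?B = 1\<close> pow])
    show "finite (rcosets\<^bsub>PSL2R\<lparr>carrier := conjugate_group\<rparr>\<^esub> (conjugate_group \<inter> unit_group))"
      using commensurable_groups by (simp add: commensurable_def)
  qed (use conjugate_group_subset one_conjugate_group one_unit_group in auto)
  then obtain u where u: "u \<in> norm_one_units a b R" "psl_class (matrix_power ?B k) = psl_class (rep u)"
    by (auto simp: unit_group_def)
  \<comment> \<open>Equality in \<open>PSL2R\<close> leaves a sign undetermined; squaring removes it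
    and doubles the exponent.\<close>
  then have "matrix_power ?B k ** matrix_power ?B k = rep u ** rep u"
    by (auto simp: psl_class_eq_iff matrix_mul_minus_left matrix_mul_minus_right)
  then have "matrix_power ?B (k + k) = rep (quat_mult a b u u)"
    by (simp only: matrix_power_add rep_norm_one_units_mult[OF u(1) u(1)])
  then have "G ** matrix_power A (k + k) ** G' = rep (quat_mult a b u u)"
    unfolding matrix_power_conjugate[OF G(2,1)] .
  then show thesis using that[of "k + k"] k(1) norm_one_units_closed[OF u(1) u(1)] by simp
qed

lemma unit_power_group_element:
  assumes w: "w \<in> norm_one_units a b R" "det (rep w) = 1"
  obtains k A where "k > 0" "A \<in> \<Union>\<Gamma>" "matrix_power (rep w) k = G ** A ** G'"
proof -
  have pow: "psl_class (matrix_power (rep w) n) \<in> unit_group" for n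
  proof -
    obtain y where y: "y \<in> norm_one_units a b R" "rep y = matrix_power (rep w) n"
      using norm_one_units_power[OF w(1)] by blast
    show ?thesis unfolding unit_group_def y(2)[symmetric] using y(1) by (rule imageI)
  qed
  obtain k where k: "k > 0" "psl_class (matrix_power (rep w) k) \<in> conjugate_group \<inter> unit_group"
  proof (rule power_in_finite_index[OF _ _ _ w(2) pow])
    show "finite (rcosets\<^bsub>PSL2R\<lparr>carrier := unit_group\<rparr>\<^esub> (conjugate_group \<inter> unit_group))"
      using commensurable_groups by (simp add: commensurable_def)
  qed (use conjugate_group_subset one_conjugate_group one_unit_group in auto)
  then obtain A where A: "A \<in> \<Union>\<Gamma>" "psl_class (matrix_power (rep w) k) = psl_class (G ** A ** G')"
    by (auto simp: conjugate_group_eq simp del: Union_iff)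
  then consider "matrix_power (rep w) k = G ** A ** G'" | "matrix_power (rep w) k = G ** (- A) ** G'"
    by (auto simp: psl_class_eq_iff matrix_mul_minus_left matrix_mul_minus_right)
  \<comment> \<open>In this direction the sign is absorbed by the group, whose preimage in
    \<open>SL2R\<close> contains negatives.\<close>
  moreover have "- A \<in> \<Union>\<Gamma>"
    using A(1) unfolding fuchsian_group_mem_iff[OF sub] by (simp add: psl_class_def det_2 insert_commute)
  ultimately show thesis using that k(1) A(1) by metis
qed

text \<open>Three exponents multiply: \<open>m\<close> brings \<open>A\<close> into the unit group,
  \<open>k\<close> keeps the conjugate by \<open>x\<close> inside the order, and \<open>l\<close>
  brings the resulting unit back into the conjugate of \<open>\<Gamma>\<close>.\<close>

lemma commensurator:
  assumes "A \<in> \<Union>\<Gamma>" and x: "x \<in> quat_points F" "det (rep x) \<noteq> 0"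
  obtains k B where "k > 0" "B \<in> \<Union>\<Gamma>" "B ** (G' ** rep x ** G) = (G' ** rep x ** G) ** matrix_power A k"
proof -
  obtain m u where u: "m > 0" "u \<in> norm_one_units a b R" "G ** matrix_power A m ** G' = rep u"
    by (rule group_element_power_unit[OF assms(1)])
  obtain k w where w: "k > 0" "w \<in> norm_one_units a b R" "rep w ** rep x = rep x ** matrix_power (rep u) k"
    by (rule norm_one_units_conjugate[OF u(2) x])
  have "det A = 1" using assms fuchsian_group_mem_iff[OF sub] by blast
  then have "det (rep u) = 1" unfolding u(3)[symmetric] by (simp add: det_mul det_matrix_power G)
  \<comment> \<open>The determinant is carried over from \<open>A\<close> along the conjugations,
    not computed from the quaternion norm.\<close>
  then have "det (rep w) = 1"
    using arg_cong[OF w(3), of det] x(2) by (simp add: det_mul det_matrix_power)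
  then obtain l B where B: "l > 0" "B \<in> \<Union>\<Gamma>" "matrix_power (rep w) l = G ** B ** G'"
    using unit_power_group_element[OF w(2)] by blast
  have "G ** B ** G' ** rep x = rep x ** (G ** matrix_power A (m * k * l) ** G')"
    using matrix_power_intertwine[OF w(3), of l]
    unfolding B(3) u(3)[symmetric] matrix_power_conjugate[OF G(2,1)] matrix_power_power .
  then have "G' ** (G ** B ** G' ** rep x) ** G = G' ** (rep x ** (G ** matrix_power A (m * k * l) ** G')) ** G"
    by simp
  moreover have "G' ** (G ** M) = M" "M ** G' ** G = M" for M
    using G by (simp add: matrix_mul_assoc, simp add: matrix_mul_assoc[symmetric])
  ultimately have "B ** (G' ** rep x ** G) = (G' ** rep x ** G) ** matrix_power A (m * k * l)"
    by (simp add: matrix_mul_assoc)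
  then show thesis using that[of "m * k * l" B] u(1) w(1) B(1,2) by simp
qed

end

lemma arithmetic_fuchsian_groupE:
  assumes "arithmetic_fuchsian_group \<Gamma>"
  obtains F a b \<sigma> R \<phi> G G' where "arithmetic_group F a b \<sigma> R \<phi> \<Gamma> G G'"
proof -
  obtain F a b \<sigma> R \<phi> g where *: "totally_real_number_field F" "a \<in> F - {0}" "b \<in> F - {0}"
    "{\<tau> \<in> real_places F. split_at a b \<tau>} = {\<sigma>}"
    "quat_order F a b R" "quat_matrix_iso (\<sigma> a) (\<sigma> b) \<phi>" "g \<in> carrier PSL2R"
    "commensurable PSL2R
      (g <#\<^bsub>PSL2R\<^esub> \<Gamma> #>\<^bsub>PSL2R\<^esub> (inv\<^bsub>PSL2R\<^esub> g))
      ((\<lambda>x. {mat 1, - mat 1} #>\<^bsub>SL2R\<^esub> \<phi> (quat_map \<sigma> x)) ` norm_one_units a b R)"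
    using assms unfolding arithmetic_fuchsian_group_def by blast
  obtain G where G: "g = psl_class G" "det G = 1" using *(7) by (auto simp: carrier_PSL2R)
  obtain G' where G': "G ** G' = mat 1" "G' ** G = mat 1" "det G' = 1"
    using inverse_matrix_det_1[OF G(2)] .
  have "quaternion_order_splitting F a b \<sigma> R \<phi>"
    using *(1-6) unfolding totally_real_number_field_def
    by (intro quaternion_order_splitting.intro) auto
  moreover have "subgroup \<Gamma> PSL2R"
    using assms by (simp add: arithmetic_fuchsian_group_def fuchsian_group_def)
  ultimately have "arithmetic_group F a b \<sigma> R \<phi> \<Gamma> G G'"
    using *(8) G G' by (simp add: arithmetic_group_def arithmetic_group_axioms_def)
  then show thesis using that by blast
qed

section \<open>Translating an intersection\<close>

lemma passage_periodic:
  assumes "\<alpha> \<in> primitive_closed_geodesics \<Gamma>" "p \<in> passages \<alpha> z" "f \<in> p"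
  obtains L where "L > 0" "\<And>t. f (t + L) = f t"
proof -
  obtain c L where \<alpha>: "\<alpha> = {\<lambda>t. c (\<epsilon> * t + s) | \<epsilon> s. \<epsilon> \<in> {1, - 1 :: real}}"
    and "primitive_closed_geodesic \<Gamma> c L"
    using assms(1) unfolding primitive_closed_geodesics_def by blast
  then have L: "L > 0" "\<And>t. c (t + L) = c t"
    by (auto simp: primitive_closed_geodesic_def closed_geodesic_def)
  \<comment> \<open>For a parametrisation with reversed orientation, which runs backwards through
    \<open>c\<close>.\<close>
  have L': "c (t - L) = c t" for t using L(2)[of "t - L"] by simp
  obtain c' where "c' \<in> \<alpha>" and f: "f = c' \<or> f = (\<lambda>t. c' (- t))"
    using assms(2,3) by (auto simp: passages_def)
  obtain \<epsilon> s where \<epsilon>: "\<epsilon> = 1 \<or> \<epsilon> = - 1" "c' = (\<lambda>t. c (\<epsilon> * t + s))"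
    using \<open>c' \<in> \<alpha>\<close> unfolding \<alpha> by blast
  then have "f = (\<lambda>t. c (\<epsilon> * t + s)) \<or> f = (\<lambda>t. c (- \<epsilon> * t + s))"
    using f by auto
  moreover have "- \<epsilon> = 1 \<or> - \<epsilon> = - 1" using \<epsilon>(1) by auto
  ultimately obtain \<eta> where "\<eta> = 1 \<or> \<eta> = - 1" "f = (\<lambda>t. c (\<eta> * t + s))"
    using \<epsilon>(1) by blast
  moreover have "c (t + L + s) = c (t + s)" "c (- t - L + s) = c (- t + s)" for t
    using L(2)[of "t + s"] L'[of "- t + s"] by (simp_all add: algebra_simps)
  ultimately have "f (t + L) = f t" for t by auto
  then show thesis using that L(1) by blast
qed

lemma mobius_act_matrix_power:
  assumes "det A = 1" "\<And>t. \<gamma> (t + L) = mobius_act A (\<gamma> t)" "geodesic_line \<gamma>"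
  shows "mobius_act (matrix_power A k) (\<gamma> t) = \<gamma> (t + real k * L)"
proof (induction k)
  case (Suc k)
  have "mobius_act (matrix_power A (Suc k)) (\<gamma> t) = mobius_act A (\<gamma> (t + real k * L))"
    using assms(1) Im_geodesic_line[OF assms(3)] Suc by (simp add: mobius_act_mult det_matrix_power)
  then show ?case by (simp add: algebra_simps flip: assms(2))
qed simp

lemma has_vector_derivative_mobius_act:
  assumes "(\<gamma> has_vector_derivative u) (at 0)" "det A \<noteq> 0" "Im (\<gamma> 0) > 0"
  shows "((\<lambda>t. mobius_act A (\<gamma> t)) has_vector_derivative
    u * (of_real (det A) / (mobius_denom A (\<gamma> 0))\<^sup>2)) (at 0)"
  using field_vector_diff_chain_at[OF assms(1) has_field_derivative_mobius_act[OF assms(2,3)]]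
  by (simp add: o_def)

lemma ccw_line_angle_mult:
  assumes "ccw_line_angle u v \<theta>" "m \<noteq> 0"
  shows "ccw_line_angle (u * m) (v * m) \<theta>"
  using assms unfolding ccw_line_angle_def by (auto simp: mult_ac)

context discrete_matrix_group begin

text \<open>\<open>L\<close> may be any period: a translated line comes with a multiple of the old
  one, which need not be minimal.\<close>

lemma closed_geodesic_passage:
  assumes "geodesic_line \<gamma>" "L > 0" "\<And>t. orbit_of \<Gamma> (\<gamma> (t + L)) = orbit_of \<Gamma> (\<gamma> t)"
  obtains \<alpha> p where "\<alpha> \<in> primitive_closed_geodesics \<Gamma>" "p \<in> passages \<alpha> (orbit_of \<Gamma> (\<gamma> 0))"
    "(\<lambda>t. orbit_of \<Gamma> (\<gamma> t)) \<in> p"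
proof -
  define c where "c = (\<lambda>t. orbit_of \<Gamma> (\<gamma> t))"
  define \<alpha> where "\<alpha> = {\<lambda>t. c (\<epsilon> * t + s) | \<epsilon> s. \<epsilon> \<in> {1, - 1 :: real}}"
  have "\<exists>L. primitive_closed_geodesic \<Gamma> c L"
    unfolding c_def by (rule primitive_closed_geodesic_ex[OF assms])
  then have "\<alpha> \<in> primitive_closed_geodesics \<Gamma>"
    unfolding primitive_closed_geodesics_def \<alpha>_def by blast
  moreover have "c \<in> \<alpha>" unfolding \<alpha>_def by (intro CollectI exI[of _ 1] exI[of _ 0]) auto
  then have "{c, \<lambda>t. c (- t)} \<in> passages \<alpha> (orbit_of \<Gamma> (\<gamma> 0))"
    unfolding passages_def by (intro CollectI exI[of _ c]) (auto simp: c_def)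
  ultimately show thesis using that unfolding c_def by blast
qed

text \<open>Closedness of the translated lines comes from commensuration, equality of the angle from
  conformality of the action of \<open>Y\<close>.\<close>

lemma intersection_translate:
  assumes \<gamma>: "geodesic_line \<gamma>" "L > 0" "\<And>t. orbit_of \<Gamma> (\<gamma> (t + L)) = orbit_of \<Gamma> (\<gamma> t)"
    and \<delta>: "geodesic_line \<delta>" "M > 0" "\<And>t. orbit_of \<Gamma> (\<delta> (t + M)) = orbit_of \<Gamma> (\<delta> t)"
    and meet: "\<gamma> 0 = \<delta> 0" "(\<gamma> has_vector_derivative u) (at 0)" "(\<delta> has_vector_derivative v) (at 0)"
      "ccw_line_angle u v \<theta>"
    and Y: "det Y > 0"
      "\<And>A. A \<in> \<Union>\<Gamma> \<Longrightarrow> \<exists>k>0. \<exists>B\<in>\<Union>\<Gamma>. B ** Y = Y ** matrix_power A k"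
  shows "\<exists>\<alpha> \<beta> p q. (\<alpha>, \<beta>, orbit_of \<Gamma> (mobius_act Y (\<gamma> 0)), p, q) \<in> intersections_with_angle \<Gamma> \<theta>"
proof -
  \<comment> \<open>After \<open>k\<close> periods the line has moved by the \<open>k\<close>-th
    power of \<open>A\<close>. The intertwining relation turns this into a motion of the translated
    line by \<open>B\<close>, which is invisible in the quotient.\<close>
  have closed: "\<exists>L>0. \<forall>t. orbit_of \<Gamma> (mobius_act Y (\<eta> (t + L))) = orbit_of \<Gamma> (mobius_act Y (\<eta> t))"
    if \<eta>: "geodesic_line \<eta>" "L > 0" "\<And>t. orbit_of \<Gamma> (\<eta> (t + L)) = orbit_of \<Gamma> (\<eta> t)" for \<eta> L
  proof -
    obtain A where A: "A \<in> \<Union>\<Gamma>" "\<And>t. \<eta> (t + L) = mobius_act A (\<eta> t)"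
      using closed_geodesic_translation[OF \<eta>(1,3)] by blast
    obtain k B where k: "k > 0" "B \<in> \<Union>\<Gamma>" "B ** Y = Y ** matrix_power A k" using Y(2)[OF A(1)] by blast
    have Im: "Im (\<eta> t) > 0" for t using \<eta>(1) by (rule Im_geodesic_line)
    have "orbit_of \<Gamma> (mobius_act Y (\<eta> (t + real k * L))) = orbit_of \<Gamma> (mobius_act Y (\<eta> t))" for t
    proof -
      have "mobius_act Y (\<eta> (t + real k * L)) = mobius_act (Y ** matrix_power A k) (\<eta> t)"
        using det_eq_1[OF A(1)] Im[of t]
        by (simp add: mobius_act_mult det_matrix_power mobius_act_matrix_power[OF _ A(2) \<eta>(1)])
      also have "\<dots> = mobius_act B (mobius_act Y (\<eta> t))"
        unfolding k(3)[symmetric] using Y(1) Im by (rule mobius_act_mult)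
      finally show ?thesis
        using orbit_of_mobius_act[OF k(2) Im_mobius_act_pos[OF Y(1) Im]] by simp
    qed
    then show ?thesis using k(1) \<eta>(2) by (intro exI[of _ "real k * L"]) auto
  qed
  let ?\<gamma> = "\<lambda>t. mobius_act Y (\<gamma> t)" and ?\<delta> = "\<lambda>t. mobius_act Y (\<delta> t)"
  have lines: "geodesic_line ?\<gamma>" "geodesic_line ?\<delta>"
    using Y(1) \<gamma>(1) \<delta>(1) by (auto intro: geodesic_line_mobius_act)
  obtain \<alpha> p where \<alpha>: "\<alpha> \<in> primitive_closed_geodesics \<Gamma>" "p \<in> passages \<alpha> (orbit_of \<Gamma> (?\<gamma> 0))"
    "(\<lambda>t. orbit_of \<Gamma> (?\<gamma> t)) \<in> p"
    using closed[OF \<gamma>] closed_geodesic_passage[OF lines(1)] by metis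
  obtain \<beta> q where \<beta>: "\<beta> \<in> primitive_closed_geodesics \<Gamma>" "q \<in> passages \<beta> (orbit_of \<Gamma> (?\<delta> 0))"
    "(\<lambda>t. orbit_of \<Gamma> (?\<delta> t)) \<in> q"
    using closed[OF \<delta>] closed_geodesic_passage[OF lines(2)] by metis
  \<comment> \<open>The complex derivative of \<open>Y\<close> at the common point; it multiplies
    both tangent vectors.\<close>
  define m where "m = of_real (det Y) / (mobius_denom Y (\<gamma> 0))\<^sup>2"
  have Im0: "Im (\<gamma> 0) > 0" using \<gamma>(1) by (rule Im_geodesic_line)
  then have "m \<noteq> 0" using Y(1) mobius_denom_nonzero[of Y "\<gamma> 0"] by (simp add: m_def)
  have "passage_angle \<Gamma> p q \<theta>"
    unfolding passage_angle_def
  proof (intro exI conjI)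
    show "(?\<gamma> has_vector_derivative u * m) (at 0)"
      unfolding m_def using meet(2) Y(1) Im0 by (intro has_vector_derivative_mobius_act) auto
    show "(?\<delta> has_vector_derivative v * m) (at 0)"
      unfolding m_def meet(1) using meet(3) Y(1) Im0 meet(1) by (intro has_vector_derivative_mobius_act) auto
    show "ccw_line_angle (u * m) (v * m) \<theta>" using meet(4) \<open>m \<noteq> 0\<close> by (rule ccw_line_angle_mult)
  qed (use lines \<alpha>(3) \<beta>(3) meet(1) in auto)
  moreover have "orbit_of \<Gamma> (?\<gamma> 0) \<in> quotient_surface \<Gamma>"
    using Im_mobius_act_pos[OF Y(1) Im0] by (auto simp: quotient_surface_def upper_half_plane_def)
  ultimately show ?thesis
    using \<alpha>(1,2) \<beta>(1,2) meet(1) unfolding intersections_with_angle_def by auto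
qed

end

section \<open>Rational perturbations of the identity and the points to which they move
  \<open>w\<close>\<close>

lemma linear_sandwich: "linear (\<lambda>M :: real^2^2. A ** M ** B)" for A B :: "real^2^2"
  by (rule linearI) (simp_all add: vec_eq_iff matrix_matrix_mult_def sum_2 algebra_simps)

text \<open>Vanishes iff \<open>M\<close> fixes \<open>w\<close>, and unlike \<open>mobius_act M w - w\<close> it is linear in \<open>M\<close>.\<close>

definition mobius_defect :: "complex \<Rightarrow> real^2^2 \<Rightarrow> complex" where
  "mobius_defect w M = of_real (M$1$1) * w + of_real (M$1$2) - w * mobius_denom M w"

lemma linear_mobius_defect: "linear (mobius_defect w)"
  by (rule linearI)
     (simp_all add: mobius_defect_def mobius_denom_def scaleR_conv_of_real[where 'a = complex] algebra_simps)

lemma mobius_act_perturbation: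
  fixes N :: "real^2^2" and q :: real
  assumes "det (mat 1 + q *\<^sub>R N) \<noteq> 0" "Im w > 0"
  shows "1 + of_real q * mobius_denom N w \<noteq> 0"
    and "mobius_act (mat 1 + q *\<^sub>R N) w =
      w + of_real q * mobius_defect w N / (1 + of_real q * mobius_denom N w)"
proof -
  have d: "mobius_denom (mat 1 + q *\<^sub>R N) w = 1 + of_real q * mobius_denom N w"
    by (simp add: mobius_denom_def mat_def algebra_simps)
  then show nz: "1 + of_real q * mobius_denom N w \<noteq> 0"
    using mobius_denom_nonzero[OF assms] by simp
  have "mobius_act (mat 1 + q *\<^sub>R N) w =
      (w * (1 + of_real q * mobius_denom N w) + of_real q * mobius_defect w N) /
      (1 + of_real q * mobius_denom N w)"
    unfolding mobius_act_eq d by (simp add: mobius_defect_def mat_def algebra_simps)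
  then show "mobius_act (mat 1 + q *\<^sub>R N) w =
      w + of_real q * mobius_defect w N / (1 + of_real q * mobius_denom N w)"
    using nz by (simp add: add_divide_distrib)
qed

text \<open>If \<open>N\<close> moves \<open>w\<close> infinitesimally, then \<open>q\<close> can be
  recovered from the perturbed point, because \<open>q / (1 + q d)\<close> is injective in
  \<open>q\<close>. The compact set is the arc over a whole real interval near 0.\<close>

lemma infinite_rational_perturbations:
  fixes N :: "real^2^2"
  assumes "Im w > 0" "mobius_defect w N \<noteq> 0"
  obtains Q K where "Q \<subseteq> \<rat>" "\<And>q. q \<in> Q \<Longrightarrow> det (mat 1 + q *\<^sub>R N) > 0"
    "infinite ((\<lambda>q. mobius_act (mat 1 + q *\<^sub>R N) w) ` Q)"
    "(\<lambda>q. mobius_act (mat 1 + q *\<^sub>R N) w) ` Q \<subseteq> K" "compact K" "K \<subseteq> upper_half_plane"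
proof -
  let ?d = "\<lambda>q. det (mat 1 + q *\<^sub>R N)" and ?f = "\<lambda>q. mobius_act (mat 1 + q *\<^sub>R N) w"
  have "(?d \<longlongrightarrow> ?d 0) (at 0)"
    unfolding det_2 by (intro tendsto_intros)
  then have "\<forall>\<^sub>F q in at 0. ?d q > 0"
    by (rule order_tendstoD) simp
  then obtain e where e: "e > 0" "\<And>q. q \<noteq> 0 \<Longrightarrow> dist q 0 < e \<Longrightarrow> ?d q > 0"
    unfolding eventually_at by blast
  have pos: "?d q > 0" if "q \<in> {0..e / 2}" for q
    using e that by (cases "q = 0") (auto simp: dist_real_def)
  have nz: "1 + complex_of_real q * mobius_denom N w \<noteq> 0" if "q \<in> {0..e / 2}" for q
    using mobius_act_perturbation(1)[of q N w] pos[OF that] assms(1) by simp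
  have f: "?f q = w + of_real q * mobius_defect w N / (1 + of_real q * mobius_denom N w)"
    if "q \<in> {0..e / 2}" for q
    using mobius_act_perturbation(2)[of q N w] pos[OF that] assms(1) by simp
  define Q where "Q = \<rat> \<inter> {0..e / 2}"
  define K where "K = ?f ` {0..e / 2}"
  have "inj_on ?f {0..e / 2}"
  proof (rule inj_onI)
    fix q r assume qr: "q \<in> {0..e / 2}" "r \<in> {0..e / 2}" "?f q = ?f r"
    have "of_real q * mobius_defect w N / (1 + of_real q * mobius_denom N w) =
        of_real r * mobius_defect w N / (1 + of_real r * mobius_denom N w)"
      using qr(3) unfolding f[OF qr(1)] f[OF qr(2)] by (rule add_left_imp_eq)
    then have "complex_of_real q / (1 + of_real q * mobius_denom N w) = of_real r / (1 + of_real r * mobius_denom N w)"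
      using assms(2) by (simp only: times_divide_eq_left[symmetric] mult_cancel_right simp_thms)
    then have "complex_of_real q * (1 + of_real r * mobius_denom N w) = of_real r * (1 + of_real q * mobius_denom N w)"
      by (rule iffD1[OF frac_eq_eq[OF nz[OF qr(1)] nz[OF qr(2)]]])
    then show "q = r" by (simp add: algebra_simps)
  qed
  moreover have "infinite Q"
  proof -
    \<comment> \<open>The reciprocals of \<open>m + 1, m + 2, ...\<close> provide infinitely many
      rationals in the interval.\<close>
    obtain m :: nat where m: "inverse (real (Suc m)) < e / 2"
      using reals_Archimedean[of "e / 2"] e(1) by auto
    have "inj (\<lambda>n. inverse (real (Suc (n + m))))" by (rule injI) simp
    then have "infinite (range (\<lambda>n. inverse (real (Suc (n + m)))))"
      using finite_imageD infinite_UNIV_nat by blast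
    moreover have mem: "inverse (real (Suc (n + m))) \<in> Q" for n
    proof -
      have "inverse (real (Suc (n + m))) \<le> inverse (real (Suc m))"
        by (intro le_imp_inverse_le) auto
      moreover have "inverse (real (Suc (n + m))) \<in> \<rat>" by (intro Rats_inverse Rats_of_nat)
      moreover have "inverse (real (Suc (n + m))) \<ge> 0" by simp
      ultimately show ?thesis
        using m unfolding Q_def Int_iff atLeastAtMost_iff by linarith
    qed
    moreover have "range (\<lambda>n. inverse (real (Suc (n + m)))) \<subseteq> Q"
      using mem by (rule image_subsetI)
    ultimately show ?thesis using infinite_super by blast
  qed
  moreover have "Q \<subseteq> {0..e / 2}" by (simp add: Q_def)
  ultimately have "infinite (?f ` Q)"
    using finite_imageD inj_on_subset by blast
  moreover have "continuous_on {0..e / 2} ?f"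
  proof (subst continuous_on_cong[OF refl f])
    show "continuous_on {0..e / 2} (\<lambda>q. w + of_real q * mobius_defect w N / (1 + of_real q * mobius_denom N w))"
      using nz by (intro continuous_intros) auto
  qed
  then have "compact K" unfolding K_def by (intro compact_continuous_image) auto
  moreover have "K \<subseteq> upper_half_plane"
    unfolding K_def using pos assms(1) by (auto simp: upper_half_plane_def intro!: Im_mobius_act_pos)
  moreover have "Q \<subseteq> \<rat>" "?f ` Q \<subseteq> K" by (auto simp: Q_def K_def)
  moreover have "?d q > 0" if "q \<in> Q" for q using pos that by (simp add: Q_def)
  ultimately show thesis using that by blast
qed

context arithmetic_group begin

lemma iso_linear: "linear \<phi>" "bij \<phi>" "\<phi> quat_one = mat 1"
  using iso by (auto simp: quat_matrix_iso_def)

lemma rep_rational_perturbation: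
  assumes "q \<in> \<rat>" "e \<in> {(0, 1, 0, 0), (0, 0, 1, 0), (0, 0, 0, 1)}"
  shows "quat_one + q *\<^sub>R e \<in> quat_points F" "rep (quat_one + q *\<^sub>R e) = mat 1 + q *\<^sub>R \<phi> e"
proof -
  have "quat_map \<sigma> (quat_one + q *\<^sub>R e) = quat_one + q *\<^sub>R e"
    using assms by (auto simp: quat_one_def place_0 place_hom place_Rats)
  then show "rep (quat_one + q *\<^sub>R e) = mat 1 + q *\<^sub>R \<phi> e"
    using iso_linear by (simp add: rep_def linear_add linear_scale)
  show "quat_one + q *\<^sub>R e \<in> quat_points F"
    using assms by (auto simp: quat_one_def quat_points_def F_closed F_Rats)
qed

text \<open>The identity has zero defect. If \<open>i\<close>, \<open>j\<close> and \<open>k\<close>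
  had too, then by linearity and surjectivity of \<open>\<phi>\<close> every real matrix
  would.\<close>

lemma moving_direction:
  obtains e where "e \<in> {(0, 1, 0, 0), (0, 0, 1, 0), (0, 0, 0, 1)}"
    "mobius_defect w (G' ** \<phi> e ** G) \<noteq> 0"
proof (rule ccontr)
  assume "\<not> thesis"
  then have 0: "mobius_defect w (G' ** \<phi> e ** G) = 0"
    if "e \<in> {(0, 1, 0, 0), (0, 0, 1, 0), (0, 0, 0, 1)}" for e
    using that \<open>\<And>e. _ e \<Longrightarrow> _ e \<Longrightarrow> thesis\<close> by blast
  let ?h = "\<lambda>x. mobius_defect w (G' ** \<phi> x ** G)"
  have h: "linear ?h"
    using linear_compose[OF linear_compose[OF iso_linear(1) linear_sandwich] linear_mobius_defect]
    by (simp add: o_def)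
  have "?h quat_one = mobius_defect w (mat 1)" by (simp add: iso_linear G)
  also have "\<dots> = 0" by (simp add: mobius_defect_def mobius_denom_def mat_def)
  finally have "?h quat_one = 0" .
  have "?h x = 0" for x
  proof -
    obtain x0 x1 x2 x3 where x: "x = (x0, x1, x2, x3)" by (cases x) auto
    have "x = x0 *\<^sub>R quat_one + x1 *\<^sub>R (0, 1, 0, 0) + x2 *\<^sub>R (0, 0, 1, 0) + x3 *\<^sub>R (0, 0, 0, 1)"
      by (simp add: x quat_one_def)
    then have "?h x = ?h (x0 *\<^sub>R quat_one + x1 *\<^sub>R (0, 1, 0, 0) + x2 *\<^sub>R (0, 0, 1, 0) + x3 *\<^sub>R (0, 0, 0, 1))"
      by simp
    also have "\<dots> = 0"
      unfolding linear_add[OF h] linear_scale[OF h] using \<open>?h quat_one = 0\<close> 0 by simp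
    finally show ?thesis .
  qed
  \<comment> \<open>The witness is the infinitesimal translation, whose defect is 1 at every
    \<open>w\<close>.\<close>
  moreover obtain x where "\<phi> x = G ** (\<chi> i j. if i = 1 \<and> j = 2 then 1 else 0) ** G'"
    using surjD[OF bij_is_surj[OF iso_linear(2)]] by metis
  moreover have "G' ** (G ** M ** G') ** G = M" for M
  proof -
    have "G' ** (G ** M ** G') ** G = (G' ** G) ** M ** (G' ** G)" by (simp only: matrix_mul_assoc)
    then show ?thesis by (simp add: G)
  qed
  ultimately have "mobius_defect w (\<chi> i j. if i = 1 \<and> j = 2 then 1 else 0) = 0" by metis
  then show False by (simp add: mobius_defect_def mobius_denom_def)
qed

end

theorem corollary2p2p4:
  fixes \<Gamma> :: "(real^2^2) set set" and \<theta> :: real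
  assumes "arithmetic_fuchsian_group \<Gamma>"
    and "closed_hyperbolic_surface_group \<Gamma>"
    and "\<theta> \<in> angle_spectrum \<Gamma>"
  shows "infinite (intersections_with_angle \<Gamma> \<theta>)"
proof
  assume fin: "finite (intersections_with_angle \<Gamma> \<theta>)"
  obtain F a b \<sigma> R \<phi> G G' where "arithmetic_group F a b \<sigma> R \<phi> \<Gamma> G G'"
    using arithmetic_fuchsian_groupE[OF assms(1)] .
  then interpret arithmetic_group F a b \<sigma> R \<phi> \<Gamma> G G' .
  interpret discrete_matrix_group \<Gamma>
    using assms(1) by (intro fuchsian_group_discrete_matrix_group) (simp add: arithmetic_fuchsian_group_def)
  obtain \<alpha> \<beta> z p q where i: "\<alpha> \<in> primitive_closed_geodesics \<Gamma>" "\<beta> \<in> primitive_closed_geodesics \<Gamma>"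
    "p \<in> passages \<alpha> z" "q \<in> passages \<beta> z" "passage_angle \<Gamma> p q \<theta>"
    using assms(3) by (auto simp: angle_spectrum_def intersections_with_angle_def)
  obtain \<gamma> \<delta> u v where \<gamma>: "geodesic_line \<gamma>" and \<delta>: "geodesic_line \<delta>"
    and pq: "(\<lambda>t. orbit_of \<Gamma> (\<gamma> t)) \<in> p" "(\<lambda>t. orbit_of \<Gamma> (\<delta> t)) \<in> q"
    and meet: "\<gamma> 0 = \<delta> 0" "(\<gamma> has_vector_derivative u) (at 0)" "(\<delta> has_vector_derivative v) (at 0)"
      "ccw_line_angle u v \<theta>"
    using i(5) unfolding passage_angle_def by blast
  obtain L where L: "L > 0" "\<And>t. orbit_of \<Gamma> (\<gamma> (t + L)) = orbit_of \<Gamma> (\<gamma> t)"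
    using passage_periodic[OF i(1,3) pq(1)] by blast
  obtain M where M: "M > 0" "\<And>t. orbit_of \<Gamma> (\<delta> (t + M)) = orbit_of \<Gamma> (\<delta> t)"
    using passage_periodic[OF i(2,4) pq(2)] by blast
  define w where "w = \<gamma> 0"
  have "Im w > 0" unfolding w_def using \<gamma> by (rule Im_geodesic_line)
  obtain e where e: "e \<in> {(0, 1, 0, 0), (0, 0, 1, 0), (0, 0, 0, 1)}"
    and moving: "mobius_defect w (G' ** \<phi> e ** G) \<noteq> 0"
    by (rule moving_direction)
  define N where "N = G' ** \<phi> e ** G"
  obtain Q K where Q: "Q \<subseteq> \<rat>" "\<And>q. q \<in> Q \<Longrightarrow> det (mat 1 + q *\<^sub>R N) > 0"
    and K: "infinite ((\<lambda>q. mobius_act (mat 1 + q *\<^sub>R N) w) ` Q)"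
      "(\<lambda>q. mobius_act (mat 1 + q *\<^sub>R N) w) ` Q \<subseteq> K" "compact K" "K \<subseteq> upper_half_plane"
    using infinite_rational_perturbations[OF \<open>Im w > 0\<close> moving[folded N_def]] by metis
  \<comment> \<open>Only the intersection point is remembered: infinitely many points already force
    infinitely many intersections, without comparing the translated geodesics.\<close>
  have "orbit_of \<Gamma> (mobius_act (mat 1 + q *\<^sub>R N) w) \<in> (\<lambda>(\<alpha>, \<beta>, z, p, q). z) ` intersections_with_angle \<Gamma> \<theta>"
    if q: "q \<in> Q" for q
  proof -
    let ?x = "quat_one + q *\<^sub>R e" and ?Y = "mat 1 + q *\<^sub>R N"
    have x: "?x \<in> quat_points F" "rep ?x = mat 1 + q *\<^sub>R \<phi> e"
      using rep_rational_perturbation[OF _ e] Q(1) q by auto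
    have Y: "G' ** rep ?x ** G = ?Y"
      unfolding x(2) N_def
      by (simp add: linear_add[OF linear_sandwich] linear_scale[OF linear_sandwich] G)
    have "det (G' ** rep ?x ** G) > 0" using Q(2)[OF q] by (simp only: Y)
    \<comment> \<open>Invertibility of the quaternion is inferred from the perturbed matrix, where
      smallness of \<open>q\<close> gave a positive determinant.\<close>
    then have dx: "det (rep ?x) \<noteq> 0" by (auto simp: det_mul)
    have "\<exists>k>0. \<exists>B\<in>\<Union>\<Gamma>. B ** ?Y = ?Y ** matrix_power A k" if "A \<in> \<Union>\<Gamma>" for A
      using commensurator[OF that x(1) dx] unfolding Y by metis
    from intersection_translate[OF \<gamma> L \<delta> M meet Q(2)[OF q] this] show ?thesis
      unfolding w_def by force
  qed
  then have "orbit_of \<Gamma> ` (\<lambda>q. mobius_act (mat 1 + q *\<^sub>R N) w) ` Q \<subseteq>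
      (\<lambda>(\<alpha>, \<beta>, z, p, q). z) ` intersections_with_angle \<Gamma> \<theta>"
    by blast
  then have "finite (orbit_of \<Gamma> ` (\<lambda>q. mobius_act (mat 1 + q *\<^sub>R N) w) ` Q)"
    by (rule finite_surj[OF fin])
  then show False using infinite_orbits[OF K] by blast
qed

end
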